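(* For any setup in the deterministic case, \textsc{Multi-price Ranking} achieves a competitive ratio of $\min_{i\in[n]}F(\mathcal P_i)$.
   Context: Problem. A setup $\mathcal S$ consists of $n\in\mathbb N$ items; item $i$ has starting inventory $k_i\in\mathbb N$ and price set $\mathcal P_i=\{r_i^{(1)}<\dots<r_i^{(m_i)}\}$ of positive numbers; $r_i^{(0)}=0$. An arrival sequence $\mathcal A$ consists of $T$ customers and numbers $p^{(j)}_{t,i}$. Customers arrive in order; on arrival of $t$ the numbers $p^{(j)}_{t,i}$ are revealed, and the firm either offers nothing or offers one item $i$ with remaining inventory at one price $r_i^{(j)}$; the customer accepts with probability $p^{(j)}_{t,i}$ independently, earning $r_i^{(j)}$ and decreasing $i$'s inventory by one. An online algorithm decides using only $\mathcal S$, the past, and the current customer's probabilities. $\mathsf{OPT}(\mathcal S,\mathcal A)$ is the optimal value of the LP: maximize $\sum_{t,i,j}p^{(j)}_{t,i}r^{(j)}_ix^{(j)}_{t,i}$ s.t. $\sum_{t,j}p^{(j)}_{t,i}x^{(j)}_{t,i}\le k_i$ for all $i$, $\sum_{i,j}x^{(j)}_{t,i}\le1$ for all $t$, $x\ge0$. Competitive ratio $c$ on $\mathcal S$: $\mathbb E[\mathsf{ALG}(\mathcal S,\mathcal A)]\ge c\,\mathsf{OPT}(\mathcal S,\mathcal A)$ for all $\mathcal A$. In the deterministic case every $p^{(j)}_{t,i}\in\{0,1\}$; let $j_{t,i}=\max\{j\in[m_i]:p^{(j)}_{t,i}=1\}$, or $0$ if this set is empty. Value function. For $\mathcal P=\{r^{(1)}<\dots<r^{(m)}\}$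 of positive numbers, $r^{(0)}=0$, let $\alpha^{(1)},\dots,\alpha^{(m)}$ be the unique positive numbers summing to $1$ with $1-e^{-\alpha^{(1)}}=\frac{1-e^{-\alpha^{(j)}}}{1-r^{(j-1)}/r^{(j)}}$ for $j=2,\dots,m$; $F(\mathcal P)=1-e^{-\alpha^{(1)}}$. Let $L^{(j)}=\sum_{j'\le j}\alpha^{(j')}$ ($L^{(0)}=0,L^{(m)}=1$), let $\ell(w)$ be the unique $j\in[m]$ with $w\in[L^{(j-1)},L^{(j)})$ for $w\in[0,1)$ and $\ell(1)=m$, and $\Phi_{\mathcal P}(w)=r^{(\ell(w)-1)}+(r^{(\ell(w))}-r^{(\ell(w)-1)})\frac{\exp(w-L^{(\ell(w)-1)})-1}{\exp(\alpha^{(\ell(w))})-1}$ for $w\in[0,1]$. \textsc{Multi-price Ranking} (deterministic case): each item with $k_i$ units is treated as $k_i$ separate items with one unit each and price set $\mathcal P_i$. Each (single-unit) item $i$ draws $W_i$ uniformly from $[0,1]$, independently. For each customer $t$, compute $\max\big(r_i^{(j_{t,i})}-\Phi_{\mathcal P_i}(W_i)\big)$ over still-available items $i$; if strictly positive, assign a maximizing item $i$ to $t$ at price $r_i^{(j_{t,i})}$ (it becomes unavailable); otherwise do nothing. *)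

theory Defs
  imports "HOL-Probability.Probability"
begin

section \<open>Setups and arrival sequences\<close>

text \<open>
  Items are indexed by \<open>1, \<dots>, n\<close>. The entries of \<open>inventory\<close> and \<open>price_set\<close> outside this range
  play no role.
\<close>

record pricing_setup =
  num_items :: nat
  inventory :: "nat \<Rightarrow> nat"
  price_set :: "nat \<Rightarrow> real set"

definition items :: "pricing_setup \<Rightarrow> nat set" where
  "items S = {1..num_items S}"

definition valid_setup :: "pricing_setup \<Rightarrow> bool" where
  "valid_setup S \<longleftrightarrow> num_items S \<ge> 1 \<and>
     (\<forall>i\<in>items S. finite (price_set S i) \<and> price_set S i \<noteq> {} \<and> (\<forall>r\<in>price_set S i. r > 0))"

text \<open>
  For \<open>1 \<le> j \<le> card P\<close>, \<open>price P j\<close> is the \<open>j\<close>-th smallest element of the finite set \<open>P\<close>, and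
  \<open>price P 0 = 0\<close>.
\<close>

definition price :: "real set \<Rightarrow> nat \<Rightarrow> real" where
  "price P j = (0 # sorted_list_of_set P) ! j"

text \<open>
  A customer \<open>c\<close> accepts item \<open>i\<close> at its \<open>j\<close>-th price with probability \<open>c i j\<close>, where \<open>j\<close> ranges
  over \<open>{1..card (price_set S i)}\<close>. An arrival sequence is the list of its customers, so that \<open>T\<close> is
  its length and customers are numbered from \<open>0\<close>.
\<close>

type_synonym customer = "nat \<Rightarrow> nat \<Rightarrow> real"
type_synonym arrivals = "customer list"

definition price_indices :: "pricing_setup \<Rightarrow> nat \<Rightarrow> nat set" where
  "price_indices S i = {1..card (price_set S i)}"

definition deterministic :: "pricing_setup \<Rightarrow> arrivals \<Rightarrow> bool" where
  "deterministic S A \<longleftrightarrow> (\<forall>c\<in>set A. \<forall>i\<in>items S. \<forall>j\<in>price_indices S i. c i j \<in> {0, 1})"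


section \<open>The linear program and the competitive ratio\<close>

definition lp_feasible :: "pricing_setup \<Rightarrow> arrivals \<Rightarrow> (nat \<Rightarrow> nat \<Rightarrow> nat \<Rightarrow> real) \<Rightarrow> bool" where
  "lp_feasible S A x \<longleftrightarrow>
     (\<forall>i\<in>items S. (\<Sum>t<length A. \<Sum>j\<in>price_indices S i. (A ! t) i j * x t i j) \<le> real (inventory S i)) \<and>
     (\<forall>t<length A. (\<Sum>i\<in>items S. \<Sum>j\<in>price_indices S i. x t i j) \<le> 1) \<and>
     (\<forall>t<length A. \<forall>i\<in>items S. \<forall>j\<in>price_indices S i. x t i j \<ge> 0)"

definition lp_objective :: "pricing_setup \<Rightarrow> arrivals \<Rightarrow> (nat \<Rightarrow> nat \<Rightarrow> nat \<Rightarrow> real) \<Rightarrow> real" where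
  "lp_objective S A x =
     (\<Sum>t<length A. \<Sum>i\<in>items S. \<Sum>j\<in>price_indices S i. (A ! t) i j * price (price_set S i) j * x t i j)"

definition OPT :: "pricing_setup \<Rightarrow> arrivals \<Rightarrow> real" where
  "OPT S A = (SUP x\<in>{x. lp_feasible S A x}. lp_objective S A x)"

text \<open>
  \<open>alg A\<close> stands for the expected revenue of an algorithm on the arrival sequence \<open>A\<close>, and \<open>\<A>\<close> is
  the class of admissible arrival sequences.
\<close>

definition achieves_competitive_ratio ::
    "pricing_setup \<Rightarrow> arrivals set \<Rightarrow> (arrivals \<Rightarrow> real) \<Rightarrow> real \<Rightarrow> bool" where
  "achieves_competitive_ratio S \<A> alg c \<longleftrightarrow> (\<forall>A\<in>\<A>. alg A \<ge> c * OPT S A)"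


section \<open>The value function\<close>

text \<open>The value \<open>0\<close> outside \<open>{1..card P}\<close> only serves to make the function unique.\<close>

definition alpha :: "real set \<Rightarrow> nat \<Rightarrow> real" where
  "alpha P = (THE a.
     (\<forall>j. j \<notin> {1..card P} \<longrightarrow> a j = 0) \<and>
     (\<forall>j\<in>{1..card P}. a j > 0) \<and>
     (\<Sum>j=1..card P. a j) = 1 \<and>
     (\<forall>j\<in>{2..card P}. 1 - exp (- a 1) = (1 - exp (- a j)) / (1 - price P (j - 1) / price P j)))"

definition F_ratio :: "real set \<Rightarrow> real" where
  "F_ratio P = 1 - exp (- alpha P 1)"

definition L_sum :: "real set \<Rightarrow> nat \<Rightarrow> real" where
  "L_sum P j = (\<Sum>j'=1..j. alpha P j')"

definition ell :: "real set \<Rightarrow> real \<Rightarrow> nat" where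
  "ell P w = (if w = 1 then card P
     else (THE j. j \<in> {1..card P} \<and> w \<in> {L_sum P (j - 1)..<L_sum P j}))"

definition Phi :: "real set \<Rightarrow> real \<Rightarrow> real" where
  "Phi P w = (let l = ell P w in
     price P (l - 1) + (price P l - price P (l - 1)) *
       ((exp (w - L_sum P (l - 1)) - 1) / (exp (alpha P l) - 1)))"


section \<open>Multi-price Ranking in the deterministic case\<close>

text \<open>\<open>(i, q)\<close> with \<open>q < inventory S i\<close> is the \<open>q\<close>-th single-unit copy of item \<open>i\<close>.\<close>

type_synonym copy = "nat \<times> nat"

definition copies :: "pricing_setup \<Rightarrow> copy set" where
  "copies S = (SIGMA i:items S. {..<inventory S i})"

definition best_index :: "pricing_setup \<Rightarrow> customer \<Rightarrow> nat \<Rightarrow> nat" where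
  "best_index S c i =
     (let J = {j\<in>price_indices S i. c i j = 1} in if J = {} then 0 else Max J)"

definition best_price :: "pricing_setup \<Rightarrow> customer \<Rightarrow> copy \<Rightarrow> real" where
  "best_price S c u = price (price_set S (fst u)) (best_index S c (fst u))"

definition score :: "pricing_setup \<Rightarrow> (copy \<Rightarrow> real) \<Rightarrow> customer \<Rightarrow> copy \<Rightarrow> real" where
  "score S w c u = best_price S c u - Phi (price_set S (fst u)) (w u)"

text \<open>A history lists the previous customers together with the copies assigned to them.\<close>

type_synonym history = "(customer \<times> copy option) list"

definition available :: "pricing_setup \<Rightarrow> history \<Rightarrow> copy set" where
  "available S h = {u\<in>copies S. Some u \<notin> snd ` set h}"

definition maximizers :: "pricing_setup \<Rightarrow> (copy \<Rightarrow> real) \<Rightarrow> history \<Rightarrow> customer \<Rightarrow> copy set" where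
  "maximizers S w h c =
     {u\<in>available S h. \<forall>v\<in>available S h. score S w c v \<le> score S w c u}"

text \<open>
  The algorithm does not say which maximizing copy is assigned in case of a tie. This choice is made
  by an arbitrary rule, which may depend on the random draws, the history, the current customer and
  the set of candidates.
\<close>

type_synonym tie_rule = "(copy \<Rightarrow> real) \<Rightarrow> history \<Rightarrow> customer \<Rightarrow> copy set \<Rightarrow> copy"

definition valid_tie_rule :: "tie_rule \<Rightarrow> bool" where
  "valid_tie_rule tb \<longleftrightarrow> (\<forall>w h c B. B \<noteq> {} \<longrightarrow> tb w h c B \<in> B)"

definition assign :: "pricing_setup \<Rightarrow> tie_rule \<Rightarrow> (copy \<Rightarrow> real) \<Rightarrow> history \<Rightarrow> customer \<Rightarrow> copy option" where
  "assign S tb w h c =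
     (let B = {u\<in>maximizers S w h c. score S w c u > 0}
      in if B = {} then None else Some (tb w h c B))"

primrec ranking_revenue ::
    "pricing_setup \<Rightarrow> tie_rule \<Rightarrow> (copy \<Rightarrow> real) \<Rightarrow> history \<Rightarrow> arrivals \<Rightarrow> real" where
  "ranking_revenue S tb w h [] = 0"
| "ranking_revenue S tb w h (c # cs) =
     (let d = assign S tb w h c
      in (case d of None \<Rightarrow> 0 | Some u \<Rightarrow> best_price S c u)
         + ranking_revenue S tb w (h @ [(c, d)]) cs)"

text \<open>
  The product measure is completed because ties have probability zero but are broken in an arbitrary,
  possibly non-measurable way.
\<close>

definition draws :: "pricing_setup \<Rightarrow> (copy \<Rightarrow> real) measure" where
  "draws S = completion (Pi\<^sub>M (copies S) (\<lambda>_. uniform_measure lborel {0..1}))"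

definition ranking_expected_revenue :: "pricing_setup \<Rightarrow> tie_rule \<Rightarrow> arrivals \<Rightarrow> real" where
  "ranking_expected_revenue S tb A = (\<integral>w. ranking_revenue S tb w [] A \<partial>draws S)"

end

(*
  Primal-dual analysis with s = min F. Selling unit u with draw W to customer t at price r is split
  into s * (r - Phi W) for the customer and r - s * (r - Phi W) for the unit. The expected shares,
  scaled by 1/s, form a feasible solution of the dual LP. To see this, fix the draws of all other
  units and let y be the best score available to customer t if unit u were absent. The customer's
  share is at least s * y, and u is sold whenever Phi W < r - y. Since a sale requires a price above
  Phi W, hence at least r^(ell W), the unit then gets at least s * Phi' W: the equations for alpha
  say that F * Phi' W = r^(ell W) - F * (r^(ell W) - Phi W). Integrating over W with
  Phi W < r - y gives at least s * (r - y).
*)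

theory Submission
  imports Defs
begin

text \<open>One fraction \<open>s\<close> serves all items because the customer's share is bounded
  through whichever unit wins, perhaps of another item than \<open>u\<close>: only with a common
  fraction do larger scores mean larger shares. A dual constraint can fail for a single outcome,
  since a high draw may leave \<open>u\<close> unsold and \<open>t\<close> with little. It is
  recovered by integrating over the draw of \<open>u\<close> alone, with the other draws arbitrary.
  As \<open>u\<close> may be gone before \<open>t\<close> arrives, at a price unrelated to
  \<open>r\<close>, its share must be bounded by a function of \<open>W\<close> alone. Taking
  \<open>F * Phi'\<close> for that function gives the linear equation
  \<open>F * Phi' = (1 - F) * r^(l) + F * Phi\<close> on segment \<open>l\<close>. Its solution
  climbs from \<open>r^(l-1)\<close> to \<open>r^(l)\<close> in time \<open>a\<close> exactly if
  \<open>1 - exp (- a) = F * (1 - r^(l-1) / r^(l))\<close>. The weights are these times, and their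
  sum being 1 determines \<open>F\<close>. A tie rule may depend on all draws, which can spoil both
  monotonicity in the set of units and measurability; hence the analysis of a run without any
  rule.\<close>

section \<open>Greedy assignment\<close>

text \<open>
  Here all tied winners are removed at once. This run satisfies the bound on expected shares even
  in the presence of ties, and it agrees with the algorithm almost surely.
\<close>

definition winners :: "('u \<Rightarrow> real) \<Rightarrow> 'u set \<Rightarrow> 'u set" where
  "winners s V = {u\<in>V. s u > 0 \<and> (\<forall>v\<in>V. s v \<le> s u)}"

primrec remaining :: "(nat \<Rightarrow> 'u \<Rightarrow> real) \<Rightarrow> 'u set \<Rightarrow> nat \<Rightarrow> 'u set" where
  "remaining s V 0 = V"
| "remaining s V (Suc t) = remaining s V t - winners (s t) (remaining s V t)"

lemma winners_subset: "winners s V \<subseteq> V"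
  by (auto simp: winners_def)

lemma remaining_subset: "remaining s V t \<subseteq> V"
  by (induction t) auto

text \<open>\<open>remaining\<close> unfolds at the last customer while
  \<open>ranking_revenue\<close> recurses on the first; this peels off the first one.\<close>

lemma remaining_Suc_shift:
  "remaining s V (Suc t) = remaining (\<lambda>n. s (Suc n)) (V - winners (s 0) V) t"
  by (induction t) auto

lemma remaining_cong:
  assumes "\<And>n v. n < t \<Longrightarrow> v \<in> V \<Longrightarrow> s n v = s' n v"
  shows "remaining s V t = remaining s' V t"
  using assms
proof (induction t)
  case (Suc t)
  then have "remaining s V t = remaining s' V t" by simp
  moreover have "winners (s t) (remaining s' V t) = winners (s' t) (remaining s' V t)"
    using Suc.prems[of t] remaining_subset[of s' V t] by (auto simp: winners_def subset_iff)
  ultimately show ?case by simp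
qed simp

text \<open>A unit that wins within a larger pool also wins within any smaller pool containing it.
  So whatever leaves the larger run has left the smaller one by the same time.\<close>

lemma remaining_mono:
  assumes "V \<subseteq> V'"
  shows "remaining s V t \<subseteq> remaining s V' t"
proof (induction t)
  case (Suc t)
  then show ?case by (auto simp: winners_def subset_iff)
qed (use assms in simp)

text \<open>An unsold unit has not influenced the run so far. A winner of the run without
  \<open>u\<close> also wins in the presence of \<open>u\<close>: were it outscored by
  \<open>u\<close>, then \<open>u\<close> would win itself and be gone.\<close>

lemma remaining_remove:
  assumes "u \<in> remaining s V t"
  shows "remaining s V t \<subseteq> insert u (remaining s (V - {u}) t)"
  using assms
proof (induction t)
  case (Suc t)
  let ?R = "remaining s V t" and ?R' = "remaining s (V - {u}) t"
  have u: "u \<in> ?R" "u \<notin> winners (s t) ?R" using Suc.prems by auto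
  have sub: "?R \<subseteq> insert u ?R'" using Suc.IH u by simp
  have "winners (s t) ?R' \<subseteq> winners (s t) ?R"
  proof
    fix v assume v: "v \<in> winners (s t) ?R'"
    have vR: "v \<in> ?R"
      using v remaining_mono[of "V - {u}" V s t] by (auto simp: winners_def)
    from v have pos: "s t v > 0" and mx: "\<And>x. x \<in> ?R' \<Longrightarrow> s t x \<le> s t v"
      by (auto simp: winners_def)
    have "s t u \<le> s t v"
    proof (rule ccontr)
      assume less: "\<not> s t u \<le> s t v"
      have "s t x \<le> s t u" if "x \<in> ?R" for x
        using that sub mx[of x] less by (cases "x = u") auto
      then have "u \<in> winners (s t) ?R"
        using u(1) pos less by (simp add: winners_def)
      with u(2) show False by simp
    qed
    then show "v \<in> winners (s t) ?R"
      using vR pos mx sub by (auto simp: winners_def)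
  qed
  then show ?case using sub by auto
qed auto

lemma removed_imp_winner:
  assumes "u \<in> V" "u \<notin> remaining s V t"
  obtains t' where "t' < t" "u \<in> winners (s t') (remaining s V t')"
proof -
  from assms have "\<exists>t'<t. u \<in> winners (s t') (remaining s V t')"
  proof (induction t)
    case (Suc t)
    then show ?case using less_Suc_eq by auto
  qed simp
  then show ?thesis using that by blast
qed

lemma obtain_winner:
  assumes "finite V" "v \<in> V" "s v > 0"
  obtains v' where "v' \<in> winners s V" "s v \<le> s v'"
proof -
  have "Max (s ` V) \<in> s ` V" using assms by (intro Max_in) auto
  then obtain v' where v': "v' \<in> V" "s v' = Max (s ` V)" by auto
  then have "\<And>x. x \<in> V \<Longrightarrow> s x \<le> s v'" using assms(1) by simp
  with v' assms have "v' \<in> winners s V" "s v \<le> s v'"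
    unfolding winners_def by (auto intro: less_le_trans)
  then show ?thesis by (rule that)
qed

section \<open>Random draws and the two shares of the revenue\<close>

abbreviation unif01 :: "real measure" where
  "unif01 \<equiv> uniform_measure lborel {0..1}"

lemma prob_space_unif01: "prob_space unif01"
  by (rule prob_space_uniform_measure) auto

lemma AE_unif01: "AE x in unif01. x \<in> {0..1}"
  by (rule AE_uniform_measureI) auto

text \<open>
  \<open>p t u\<close> is the revenue that \<open>u\<close> yields from customer \<open>t\<close>, and \<open>h\<close> plays the role of
  \<open>\<sigma> * \<phi>'\<close>.
\<close>

locale ranking =
  fixes U :: "'u set" and T :: nat and p :: "nat \<Rightarrow> 'u \<Rightarrow> real"
    and \<phi> h :: "'u \<Rightarrow> real \<Rightarrow> real" and \<sigma> :: real
  assumes finite_U: "finite U"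
    and sigma: "0 \<le> \<sigma>" "\<sigma> \<le> 1"
    and p_nonneg: "\<And>t u. t < T \<Longrightarrow> u \<in> U \<Longrightarrow> 0 \<le> p t u"
    and phi_nonneg: "\<And>u x. u \<in> U \<Longrightarrow> 0 \<le> \<phi> u x"
    and phi_measurable: "\<And>u. u \<in> U \<Longrightarrow> \<phi> u \<in> borel_measurable borel"
    and h_measurable: "\<And>u. u \<in> U \<Longrightarrow> h u \<in> borel_measurable borel"
    and h_nonneg: "\<And>u x. u \<in> U \<Longrightarrow> 0 \<le> h u x"
    and h_le: "\<And>t u x. t < T \<Longrightarrow> u \<in> U \<Longrightarrow> x \<in> {0..1} \<Longrightarrow> \<phi> u x < p t u \<Longrightarrow>
                 h u x \<le> (1 - \<sigma>) * p t u + \<sigma> * \<phi> u x"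
    and h_integral: "\<And>t u z. t < T \<Longrightarrow> u \<in> U \<Longrightarrow> 0 \<le> z \<Longrightarrow> z \<le> p t u \<Longrightarrow>
                 ennreal (\<sigma> * z) \<le> (\<integral>\<^sup>+x. ennreal (if \<phi> u x < z then h u x else 0) \<partial>unif01)"
begin

definition sc :: "('u \<Rightarrow> real) \<Rightarrow> nat \<Rightarrow> 'u \<Rightarrow> real" where
  "sc w t u = p t u - \<phi> u (w u)"

definition sold :: "('u \<Rightarrow> real) \<Rightarrow> nat \<Rightarrow> 'u set" where
  "sold w t = winners (sc w t) (remaining (sc w) U t)"

text \<open>The sum runs over the fixed set \<open>U\<close> rather than over
  \<open>sold w t\<close>, so that measurability can be shown unit by unit.\<close>

definition customer_share :: "('u \<Rightarrow> real) \<Rightarrow> nat \<Rightarrow> real" where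
  "customer_share w t = (\<Sum>u\<in>U. if u \<in> sold w t then \<sigma> * sc w t u else 0)"

definition item_share :: "('u \<Rightarrow> real) \<Rightarrow> 'u \<Rightarrow> real" where
  "item_share w u = (\<Sum>t<T. if u \<in> sold w t then p t u - \<sigma> * sc w t u else 0)"

definition revenue :: "('u \<Rightarrow> real) \<Rightarrow> real" where
  "revenue w = (\<Sum>t<T. \<Sum>u\<in>sold w t. p t u)"

abbreviation prod_unif :: "('u \<Rightarrow> real) measure" where
  "prod_unif \<equiv> Pi\<^sub>M U (\<lambda>_. unif01)"

lemma sold_subset: "sold w t \<subseteq> U"
  unfolding sold_def using winners_subset remaining_subset by fast

lemma revenue_split: "revenue w = (\<Sum>t<T. customer_share w t) + (\<Sum>u\<in>U. item_share w u)"
proof -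
  have "(\<Sum>u\<in>U. item_share w u) =
      (\<Sum>t<T. \<Sum>u\<in>U. if u \<in> sold w t then p t u - \<sigma> * sc w t u else 0)"
    unfolding item_share_def by (rule sum.swap)
  then have "(\<Sum>t<T. customer_share w t) + (\<Sum>u\<in>U. item_share w u) =
      (\<Sum>t<T. \<Sum>u\<in>U. (if u \<in> sold w t then \<sigma> * sc w t u else 0) +
        (if u \<in> sold w t then p t u - \<sigma> * sc w t u else 0))"
    by (simp only: customer_share_def sum.distrib)
  also have "\<dots> = (\<Sum>t<T. \<Sum>u\<in>U. if u \<in> sold w t then p t u else 0)"
    by (rule sum.cong[OF refl], rule sum.cong[OF refl]) simp
  also have "\<dots> = revenue w"
    unfolding revenue_def using sold_subset finite_U
    by (simp add: sum.inter_restrict[symmetric] Int_absorb1)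
  finally show ?thesis by simp
qed

lemma sold_pos: "u \<in> sold w t \<Longrightarrow> 0 < sc w t u"
  by (simp add: sold_def winners_def)

lemma sold_nonneg: "u \<in> sold w t \<Longrightarrow> 0 \<le> sc w t u"
  by (simp add: sold_pos less_imp_le)

lemma customer_share_nonneg: "0 \<le> customer_share w t"
  unfolding customer_share_def
  by (intro sum_nonneg) (auto intro!: mult_nonneg_nonneg sigma sold_nonneg)

text \<open>What the unit keeps is
  \<open>(1 - \<sigma>) * p t u + \<sigma> * \<phi> u (w u)\<close>, a convex combination of
  nonnegative numbers.\<close>

lemma sigma_sc_le:
  assumes "t < T" "u \<in> U"
  shows "\<sigma> * sc w t u \<le> p t u"
proof -
  have "p t u - \<sigma> * sc w t u = (1 - \<sigma>) * p t u + \<sigma> * \<phi> u (w u)"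
    by (simp add: sc_def algebra_simps)
  also have "\<dots> \<ge> 0" using assms sigma p_nonneg phi_nonneg by simp
  finally show ?thesis by simp
qed

lemma item_share_nonneg: "u \<in> U \<Longrightarrow> 0 \<le> item_share w u"
  unfolding item_share_def by (intro sum_nonneg) (auto simp: sigma_sc_le)

section \<open>Measurability and integrability of the shares\<close>

lemma measurable_sc [measurable]:
  assumes "u \<in> U" shows "(\<lambda>w. sc w t u) \<in> borel_measurable prod_unif"
proof -
  have [measurable]: "\<phi> u \<in> borel_measurable borel" using phi_measurable assms by simp
  have [measurable]: "(\<lambda>w. w u) \<in> prod_unif \<rightarrow>\<^sub>M borel"
    using measurable_component_singleton[OF assms, of "\<lambda>_. unif01"]
    by (simp cong: measurable_cong_sets)
  show ?thesis unfolding sc_def by measurable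
qed

lemma measurable_winners:
  assumes R: "\<And>v. v \<in> U \<Longrightarrow> Measurable.pred prod_unif (\<lambda>w. v \<in> R w)"
    and sub: "\<And>w. R w \<subseteq> U" and u: "u \<in> U"
  shows "Measurable.pred prod_unif (\<lambda>w. u \<in> winners (sc w t) (R w))"
proof -
  note [measurable] = R[OF u] measurable_sc[OF u]
  \<comment> \<open>Quantifying over the fixed finite \<open>U\<close> instead of the random set
    \<open>R w\<close> leaves a finite conjunction of measurable conditions.\<close>
  have eq: "(\<lambda>w. u \<in> winners (sc w t) (R w)) =
      (\<lambda>w. u \<in> R w \<and> 0 < sc w t u \<and> (\<forall>v\<in>U. v \<in> R w \<longrightarrow> sc w t v \<le> sc w t u))"
    using sub by (auto simp: winners_def fun_eq_iff subset_iff)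
  have "Measurable.pred prod_unif (\<lambda>w. \<forall>v\<in>U. v \<in> R w \<longrightarrow> sc w t v \<le> sc w t u)"
  proof (intro pred_intros_finite finite_U)
    fix v assume v: "v \<in> U"
    show "Measurable.pred prod_unif (\<lambda>w. v \<in> R w \<longrightarrow> sc w t v \<le> sc w t u)"
      by (intro pred_intros_logic R v)
        (simp only: pred_def borel_measurable_le[OF measurable_sc[OF v] measurable_sc[OF u]])
  qed
  then show ?thesis unfolding eq
    by (intro pred_intros_logic R u) (simp_all add: pred_def)
qed

lemma measurable_remaining:
  "u \<in> U \<Longrightarrow> Measurable.pred prod_unif (\<lambda>w. u \<in> remaining (sc w) U t)"
proof (induction t arbitrary: u)
  case (Suc t)
  note [measurable] = Suc.IH[OF Suc.prems]
    measurable_winners[of "\<lambda>w. remaining (sc w) U t", OF Suc.IH remaining_subset Suc.prems, of t]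
  show ?case by simp
qed simp

lemma measurable_sold:
  "u \<in> U \<Longrightarrow> Measurable.pred prod_unif (\<lambda>w. u \<in> sold w t)"
  unfolding sold_def by (intro measurable_winners measurable_remaining remaining_subset)

lemma measurable_customer_share: "(\<lambda>w. customer_share w t) \<in> borel_measurable prod_unif"
  unfolding customer_share_def
proof (rule borel_measurable_sum)
  fix u assume u: "u \<in> U"
  note [measurable] = measurable_sold[OF u] measurable_sc[OF u]
  show "(\<lambda>w. if u \<in> sold w t then \<sigma> * sc w t u else 0) \<in> borel_measurable prod_unif"
    by measurable
qed

lemma measurable_item_share:
  assumes "u \<in> U" shows "(\<lambda>w. item_share w u) \<in> borel_measurable prod_unif"
proof -
  note [measurable] = measurable_sold[OF assms] measurable_sc[OF assms]
  show ?thesis unfolding item_share_def by measurable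
qed

lemma prob_space_prod_unif: "prob_space (Pi\<^sub>M V (\<lambda>_. unif01))"
  by (intro prob_space_PiM prob_space_unif01)

lemma customer_share_le: "t < T \<Longrightarrow> customer_share w t \<le> (\<Sum>u\<in>U. p t u)"
  unfolding customer_share_def
proof (rule sum_mono)
  fix u assume "t < T" "u \<in> U"
  then show "(if u \<in> sold w t then \<sigma> * sc w t u else 0) \<le> p t u"
    using sigma_sc_le[of t u w] p_nonneg by auto
qed

lemma item_share_le: "u \<in> U \<Longrightarrow> item_share w u \<le> (\<Sum>t<T. p t u)"
  unfolding item_share_def
proof (rule sum_mono)
  fix t assume "t \<in> {..<T}" "u \<in> U"
  then show "(if u \<in> sold w t then p t u - \<sigma> * sc w t u else 0) \<le> p t u"
    using sold_pos[of u w t] sigma p_nonneg by (auto intro: mult_nonneg_nonneg)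
qed

lemma integrable_customer_share: "t < T \<Longrightarrow> integrable prod_unif (\<lambda>w. customer_share w t)"
  by (rule finite_measure.integrable_const_bound[OF _ AE_I2])
    (auto intro: customer_share_le measurable_customer_share
       simp: customer_share_nonneg prob_space.finite_measure[OF prob_space_prod_unif])

lemma integrable_item_share: "u \<in> U \<Longrightarrow> integrable prod_unif (\<lambda>w. item_share w u)"
  by (rule finite_measure.integrable_const_bound[OF _ AE_I2])
    (auto intro: item_share_le measurable_item_share
       simp: item_share_nonneg prob_space.finite_measure[OF prob_space_prod_unif])

section \<open>Lower bounds on the shares, for fixed draws and in expectation\<close>

text \<open>
  Fixing the draws of all units but \<open>u\<close>, let \<open>y\<close> be the best score that customer \<open>t\<close> would find
  in the run without \<open>u\<close>. Customer \<open>t\<close> always gets at least \<open>\<sigma> * y\<close>, and \<open>u\<close> is sold whenever its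
  own score exceeds \<open>y\<close>.
\<close>

lemma shares_pointwise:
  assumes t: "t < T" and u: "u \<in> U"
  obtains y where "0 \<le> y"
    "\<And>x. x \<in> {0..1} \<Longrightarrow> \<sigma> * y + (if \<phi> u x < p t u - y then h u x else 0)
       \<le> customer_share (w(u := x)) t + item_share (w(u := x)) u"
proof -
  define R where "R = remaining (sc w) (U - {u}) t"
  \<comment> \<open>Inserting 0 covers the case that no unit of \<open>R\<close> has a positive
    score, so that the customer would get nothing without \<open>u\<close>.\<close>
  define y where "y = Max (insert 0 (sc w t ` R))"
  have finR: "finite R" unfolding R_def using remaining_subset finite_U
    by (meson finite_Diff finite_subset)
  have y0: "0 \<le> y" and yR: "\<And>v. v \<in> R \<Longrightarrow> sc w t v \<le> y"
    unfolding y_def using finR by auto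
  have y_in: "y = 0 \<or> (\<exists>v\<in>R. y = sc w t v)"
    using Max_in[of "insert 0 (sc w t ` R)"] finR unfolding y_def by auto
  show ?thesis
  proof (rule that[OF y0])
    fix x :: real assume x: "x \<in> {0..1}"
    define w' where "w' = w(u := x)"
    have sc': "sc w' n v = sc w n v" if "v \<noteq> u" for n v
      using that by (simp add: sc_def w'_def)
    \<comment> \<open>Without \<open>u\<close> its draw is never consulted, so \<open>R\<close> and
      \<open>y\<close> are the same for every \<open>x\<close>.\<close>
    have R: "R = remaining (sc w') (U - {u}) t"
      unfolding R_def by (rule remaining_cong) (simp add: sc')
    have unR: "u \<notin> R" unfolding R_def using remaining_subset by fastforce
    have sub: "R \<subseteq> remaining (sc w') U t"
      unfolding R by (rule remaining_mono) auto
    have share: "\<sigma> * y \<le> customer_share w' t"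
    proof (cases "y = 0")
      case False
      with y_in y0 obtain v where v: "v \<in> R" "y = sc w t v" "0 < y" by auto
      have "v \<noteq> u" using v unR by auto
      then have "0 < sc w' t v" "y = sc w' t v" using v by (auto simp: sc')
      moreover have "finite (remaining (sc w') U t)"
        using remaining_subset finite_U finite_subset by metis
      ultimately obtain v' where v': "v' \<in> sold w' t" "y \<le> sc w' t v'"
        using obtain_winner[of "remaining (sc w') U t" v "sc w' t"] sub v(1)
        unfolding sold_def by auto
      have "\<sigma> * y \<le> (if v' \<in> sold w' t then \<sigma> * sc w' t v' else 0)"
        using v' sigma by (auto intro: mult_left_mono)
      also have "\<dots> \<le> customer_share w' t"
        unfolding customer_share_def
        by (rule member_le_sum)
          (use v' sold_subset finite_U in \<open>auto intro!: mult_nonneg_nonneg sigma sold_nonneg\<close>)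
      finally show ?thesis .
    qed (simp add: customer_share_nonneg)
    have "(if \<phi> u x < p t u - y then h u x else 0) \<le> item_share w' u"
    proof (cases "\<phi> u x < p t u - y")
      case True
      then have su: "y < sc w' t u" by (simp add: sc_def w'_def)
      \<comment> \<open>If \<open>u\<close> is still there when \<open>t\<close> arrives, it wins,
        as it beats all of \<open>R\<close>; otherwise it went to an earlier customer, to whom
        \<open>h_le\<close> applies as well.\<close>
      obtain t' where t': "t' \<le> t" "u \<in> sold w' t'"
      proof (cases "u \<in> remaining (sc w') U t")
        case True
        then have "remaining (sc w') U t \<subseteq> insert u R"
          using remaining_remove R by metis
        moreover have "sc w' t v \<le> sc w' t u" if "v \<in> R" for v
          using yR[OF that] su sc'[of v t] that unR by (cases "v = u") auto
        ultimately have "u \<in> sold w' t"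
          using True su y0 unfolding sold_def winners_def by auto
        then show ?thesis using that[of t] by simp
      next
        case False
        then show ?thesis using removed_imp_winner[OF u False] that
          unfolding sold_def by (metis less_imp_le)
      qed
      have "0 < sc w' t' u" using t' sold_pos by simp
      then have "h u x \<le> (1 - \<sigma>) * p t' u + \<sigma> * \<phi> u x"
        using h_le[of t' u x] t t' u x by (simp add: sc_def w'_def)
      also have "\<dots> = p t' u - \<sigma> * sc w' t' u" by (simp add: sc_def w'_def algebra_simps)
      also have "\<dots> = (if u \<in> sold w' t' then p t' u - \<sigma> * sc w' t' u else 0)"
        using t' by simp
      also have "\<dots> \<le> item_share w' u"
        unfolding item_share_def
        by (rule member_le_sum) (use t t' u in \<open>auto simp: sigma_sc_le\<close>)
      finally show ?thesis using True by simp
    qed (simp add: item_share_nonneg u)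
    with share show "\<sigma> * y + (if \<phi> u x < p t u - y then h u x else 0)
       \<le> customer_share (w(u := x)) t + item_share (w(u := x)) u"
      unfolding w'_def by linarith
  qed
qed

lemma inner_integral_ge:
  assumes t: "t < T" and u: "u \<in> U"
  shows "ennreal (\<sigma> * p t u) \<le>
    (\<integral>\<^sup>+x. ennreal (customer_share (w(u := x)) t + item_share (w(u := x)) u) \<partial>unif01)"
proof -
  obtain y where y: "0 \<le> y"
    "\<And>x. x \<in> {0..1} \<Longrightarrow> \<sigma> * y + (if \<phi> u x < p t u - y then h u x else 0)
       \<le> customer_share (w(u := x)) t + item_share (w(u := x)) u"
    using shares_pointwise[OF t u] by blast
  \<comment> \<open>For \<open>y\<close> above \<open>p t u\<close> the customer's share alone is
    enough, and \<open>z = 0\<close> keeps \<open>h_integral\<close> applicable.\<close>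
  define z where "z = max 0 (p t u - y)"
  have "\<sigma> * p t u \<le> \<sigma> * y + \<sigma> * z"
    using sigma by (simp add: z_def distrib_left[symmetric] mult_left_mono)
  then have "ennreal (\<sigma> * p t u) \<le> ennreal (\<sigma> * y) + ennreal (\<sigma> * z)"
    using sigma y z_def by (simp add: ennreal_plus[symmetric] ennreal_leI del: ennreal_plus)
  also have "ennreal (\<sigma> * z) \<le> (\<integral>\<^sup>+x. ennreal (if \<phi> u x < z then h u x else 0) \<partial>unif01)"
    using h_integral[OF t u, of z] y p_nonneg[OF t u] by (simp add: z_def)
  also have "\<dots> = (\<integral>\<^sup>+x. ennreal (if \<phi> u x < p t u - y then h u x else 0) \<partial>unif01)"
  proof -
    have "\<phi> u x < z \<longleftrightarrow> \<phi> u x < p t u - y" for x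
      using phi_nonneg[OF u, of x] by (auto simp: z_def)
    then show ?thesis by simp
  qed
  finally have "ennreal (\<sigma> * p t u) \<le> ennreal (\<sigma> * y) +
      (\<integral>\<^sup>+x. ennreal (if \<phi> u x < p t u - y then h u x else 0) \<partial>unif01)"
    by (simp add: add_left_mono)
  also have "\<dots> = (\<integral>\<^sup>+x. ennreal (\<sigma> * y) + ennreal (if \<phi> u x < p t u - y then h u x else 0) \<partial>unif01)"
  proof -
    note [measurable] = phi_measurable[OF u] h_measurable[OF u]
    have meas: "(\<lambda>x. ennreal (\<sigma> * y)) \<in> borel_measurable unif01"
      "(\<lambda>x. ennreal (if \<phi> u x < p t u - y then h u x else 0)) \<in> borel_measurable unif01"
      by measurable
    have "(\<integral>\<^sup>+x. ennreal (\<sigma> * y) \<partial>unif01) = ennreal (\<sigma> * y)"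
      using prob_space.emeasure_space_1[OF prob_space_unif01]
      by (simp only: nn_integral_const mult_1_right)
    then show ?thesis by (simp only: nn_integral_add[of "\<lambda>x. ennreal (\<sigma> * y)"] meas)
  qed
  also have "\<dots> \<le> (\<integral>\<^sup>+x. ennreal (customer_share (w(u := x)) t + item_share (w(u := x)) u) \<partial>unif01)"
  proof (rule nn_integral_mono_AE, use AE_unif01 in eventually_elim)
    fix x :: real assume x: "x \<in> {0..1}"
    have "ennreal (\<sigma> * y) + ennreal (if \<phi> u x < p t u - y then h u x else 0) =
        ennreal (\<sigma> * y + (if \<phi> u x < p t u - y then h u x else 0))"
      using sigma y(1) h_nonneg[OF u] by (intro ennreal_plus[symmetric]) auto
    also have "\<dots> \<le> ennreal (customer_share (w(u := x)) t + item_share (w(u := x)) u)"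
      by (intro ennreal_leI y(2) x)
    finally show "ennreal (\<sigma> * y) + ennreal (if \<phi> u x < p t u - y then h u x else 0)
      \<le> ennreal (customer_share (w(u := x)) t + item_share (w(u := x)) u)" .
  qed
  finally show ?thesis .
qed

text \<open>The dual constraint of \<open>t\<close> and \<open>u\<close>, scaled by
  \<open>\<sigma>\<close>. As \<open>inner_integral_ge\<close> holds whatever the other draws are,
  Fubini transfers it to the joint distribution.\<close>

lemma expected_shares_ge:
  assumes t: "t < T" and u: "u \<in> U"
  shows "\<sigma> * p t u \<le>
    (\<integral>w. customer_share w t \<partial>prod_unif) + (\<integral>w. item_share w u \<partial>prod_unif)"
proof -
  interpret product_sigma_finite "\<lambda>_::'u. unif01"
    by (simp add: product_sigma_finite_def prob_space_imp_sigma_finite prob_space_unif01)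
  let ?f = "\<lambda>w. customer_share w t + item_share w u"
  note [measurable] = measurable_customer_share measurable_item_share[OF u]
  obtain V where U: "insert u V = U" and V: "u \<notin> V" "finite V"
    using mk_disjoint_insert[OF u] finite_U by (metis finite_insert)
  have int: "integrable prod_unif ?f"
    using t u integrable_customer_share integrable_item_share by simp
  have "ennreal (\<sigma> * p t u) = (\<integral>\<^sup>+w. ennreal (\<sigma> * p t u) \<partial>Pi\<^sub>M V (\<lambda>_. unif01))"
    using prob_space.emeasure_space_1[OF prob_space_prod_unif, of V] by simp
  also have "\<dots> \<le> (\<integral>\<^sup>+w. (\<integral>\<^sup>+x. ennreal (?f (w(u := x))) \<partial>unif01) \<partial>Pi\<^sub>M V (\<lambda>_. unif01))"
    by (intro nn_integral_mono inner_integral_ge t u)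
  also have "\<dots> = (\<integral>\<^sup>+w. ennreal (?f w) \<partial>Pi\<^sub>M (insert u V) (\<lambda>_. unif01))"
    by (rule product_nn_integral_insert[symmetric]) (use V in \<open>simp_all add: U\<close>)
  also have "\<dots> = (\<integral>\<^sup>+w. ennreal (?f w) \<partial>prod_unif)" by (simp add: U)
  also have "\<dots> = ennreal (\<integral>w. ?f w \<partial>prod_unif)"
    using int by (rule nn_integral_eq_integral)
      (auto simp: customer_share_nonneg item_share_nonneg u)
  finally have "\<sigma> * p t u \<le> (\<integral>w. ?f w \<partial>prod_unif)"
    using integral_nonneg_AE[of ?f prod_unif] customer_share_nonneg item_share_nonneg u
    by (subst (asm) ennreal_le_iff) (auto intro!: integral_nonneg)
  then show ?thesis
    using t u integrable_customer_share integrable_item_share by simp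
qed

section \<open>Expected revenue and the absence of ties\<close>

lemma integrable_revenue: "integrable prod_unif revenue"
  unfolding revenue_split[abs_def]
  by (intro Bochner_Integration.integrable_add Bochner_Integration.integrable_sum
      integrable_customer_share integrable_item_share) auto

lemma expected_revenue:
  "(\<integral>w. revenue w \<partial>prod_unif) =
    (\<Sum>t<T. \<integral>w. customer_share w t \<partial>prod_unif) + (\<Sum>u\<in>U. \<integral>w. item_share w u \<partial>prod_unif)"
proof -
  have "(\<integral>w. (\<Sum>t<T. customer_share w t) \<partial>prod_unif) =
      (\<Sum>t<T. \<integral>w. customer_share w t \<partial>prod_unif)"
    by (rule Bochner_Integration.integral_sum) (simp add: integrable_customer_share)
  moreover have "(\<integral>w. (\<Sum>u\<in>U. item_share w u) \<partial>prod_unif) =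
      (\<Sum>u\<in>U. \<integral>w. item_share w u \<partial>prod_unif)"
    by (rule Bochner_Integration.integral_sum) (simp add: integrable_item_share)
  moreover have "integrable prod_unif (\<lambda>w. \<Sum>t<T. customer_share w t)"
    "integrable prod_unif (\<lambda>w. \<Sum>u\<in>U. item_share w u)"
    by (auto intro!: Bochner_Integration.integrable_sum integrable_customer_share integrable_item_share)
  ultimately show ?thesis unfolding revenue_split
    by (simp only: Bochner_Integration.integral_add)
qed

text \<open>With all draws but that of \<open>u\<close> fixed, a tie pins down
  \<open>\<phi> u (w u)\<close>, and injectivity leaves at most one value for the draw, a null
  set.\<close>

lemma AE_no_ties:
  assumes u: "u \<in> U" and v: "v \<in> U" and "u \<noteq> v" and inj: "inj_on (\<phi> u) {0..1}"
  shows "AE w in prod_unif. sc w t u \<noteq> sc w t v"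
proof -
  interpret product_sigma_finite "\<lambda>_::'u. unif01"
    by (simp add: product_sigma_finite_def prob_space_imp_sigma_finite prob_space_unif01)
  note [measurable] = measurable_sc[OF u] measurable_sc[OF v]
  define N where "N = {w \<in> space prod_unif. sc w t u = sc w t v}"
  have N: "N \<in> sets prod_unif" unfolding N_def by measurable
  obtain V where U: "insert u V = U" and V: "u \<notin> V" "finite V"
    using mk_disjoint_insert[OF u] finite_U by (metis finite_insert)
  have "emeasure prod_unif N = (\<integral>\<^sup>+w. indicator N w \<partial>Pi\<^sub>M (insert u V) (\<lambda>_. unif01))"
    using N by (simp add: U)
  also have "\<dots> = (\<integral>\<^sup>+w. (\<integral>\<^sup>+x. indicator N (w(u := x)) \<partial>unif01) \<partial>Pi\<^sub>M V (\<lambda>_. unif01))"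
    by (rule product_nn_integral_insert) (use V N in \<open>simp_all add: U\<close>)
  also have "\<dots> = (\<integral>\<^sup>+w. 0 \<partial>Pi\<^sub>M V (\<lambda>_. unif01))"
  proof (rule nn_integral_cong)
    fix w :: "'u \<Rightarrow> real"
    define C where "C = {x\<in>{0..1}. \<phi> u x = p t u - sc w t v}"
    have "finite C"
    proof (cases "C = {}")
      case False
      then obtain a where "a \<in> C" by auto
      with inj have "C \<subseteq> {a}" unfolding C_def inj_on_def by auto
      then show ?thesis using finite_subset by auto
    qed simp
    then have "AE x in lborel. x \<notin> C"
      by (intro AE_not_in finite_imp_null_set_lborel)
    then have "AE x in unif01. x \<notin> C"
      by (intro AE_uniform_measureI) (simp, elim eventually_mono, blast)
    then have "AE x in unif01. indicator N (w(u := x)) = (0::ennreal)"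
      using AE_unif01
    proof eventually_elim
      case (elim x)
      then show ?case using \<open>u \<noteq> v\<close> by (auto simp: N_def C_def sc_def indicator_def)
    qed
    then show "(\<integral>\<^sup>+x. indicator N (w(u := x)) \<partial>unif01) = 0"
      by (subst nn_integral_cong_AE) auto
  qed
  finally have "N \<in> null_sets prod_unif" using N by (simp add: null_sets_def)
  then show ?thesis by (rule AE_I') (auto simp: N_def)
qed

end

section \<open>The value function as a curve\<close>

text \<open>
  The value function is extended to all reals as a sum of clamped exponentials, one per segment, so
  that continuity, monotonicity and measurability are immediate.
\<close>

locale value_curve =
  fixes m :: nat and r a :: "nat \<Rightarrow> real" and F :: real
  assumes m_pos: "1 \<le> m"
    and r_0: "r 0 = 0"
    and r_less: "\<And>j. j \<in> {1..m} \<Longrightarrow> r (j - 1) < r j"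
    and a_pos: "\<And>j. j \<in> {1..m} \<Longrightarrow> 0 < a j"
    and a_sum: "(\<Sum>j=1..m. a j) = 1"
    and F_pos: "0 < F" and F_le_1: "F \<le> 1"
    and a_eq: "\<And>j. j \<in> {1..m} \<Longrightarrow> 1 - exp (- a j) = F * (1 - r (j - 1) / r j)"
begin

definition L :: "nat \<Rightarrow> real" where
  "L j = (\<Sum>i=1..j. a i)"

definition ramp :: "nat \<Rightarrow> real \<Rightarrow> real" where
  "ramp j x = (exp (max 0 (min (x - L (j - 1)) (a j))) - 1) / (exp (a j) - 1)"

definition curve :: "real \<Rightarrow> real" where
  "curve x = (\<Sum>j=1..m. (r j - r (j - 1)) * ramp j x)"

definition slope :: "nat \<Rightarrow> real \<Rightarrow> real" where
  "slope j x = (r j - r (j - 1)) * exp (x - L (j - 1)) / (exp (a j) - 1)"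

text \<open>The right derivative of \<open>curve\<close> on \<open>[0, 1)\<close>. It is given by a
  formula because \<open>curve\<close> has kinks where two segments meet.\<close>

definition curve_deriv :: "real \<Rightarrow> real" where
  "curve_deriv x = (\<Sum>j=1..m. if L (j - 1) \<le> x \<and> x < L j then slope j x else 0)"

lemma L_0: "L 0 = 0" by (simp add: L_def)

lemma L_m: "L m = 1" unfolding L_def by (rule a_sum)

lemma L_step: "j \<in> {1..m} \<Longrightarrow> L j = L (j - 1) + a j"
  by (cases j) (simp_all add: L_def)

lemma L_mono: "i \<le> j \<Longrightarrow> j \<le> m \<Longrightarrow> L i \<le> L j"
  unfolding L_def by (rule sum_mono2) (auto intro!: less_imp_le[OF a_pos])

lemma pred_le: "j \<in> {1..m} \<Longrightarrow> j - 1 \<le> m"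
  by (rule order_trans[OF diff_le_self]) simp

lemma r_mono: "i \<le> j \<Longrightarrow> j \<le> m \<Longrightarrow> r i \<le> r j"
proof (induction j rule: dec_induct)
  case (step n)
  then show ?case using r_less[of "Suc n"] by simp
qed simp

lemma r_nonneg: "j \<le> m \<Longrightarrow> 0 \<le> r j"
  using r_mono[of 0 j] r_0 by simp

lemma r_pos: "j \<in> {1..m} \<Longrightarrow> 0 < r j"
  using r_less r_nonneg[OF pred_le] by (rule le_less_trans[rotated])

lemma r_step_nonneg: "j \<in> {1..m} \<Longrightarrow> 0 \<le> r j - r (j - 1)"
  using r_less[of j] by simp

lemma exp_a_gt_1: "j \<in> {1..m} \<Longrightarrow> 1 < exp (a j)"
  using a_pos by simp

lemma segment_exists:
  assumes "0 \<le> x" "x < 1"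
  obtains l where "l \<in> {1..m}" "L (l - 1) \<le> x" "x < L l"
proof -
  define l where "l = (LEAST l. x < L l)"
  have ex: "x < L m" using assms L_m by simp
  have less: "x < L l" unfolding l_def using ex by (rule LeastI)
  have "l \<le> m" unfolding l_def using ex by (rule Least_le)
  moreover have "l \<noteq> 0" using less assms(1) L_0 by (metis not_le)
  moreover from this have "\<not> x < L (l - 1)"
    unfolding l_def by (metis One_nat_def diff_less gr0I lessI not_less_Least)
  ultimately show ?thesis using less by (intro that[of l]) auto
qed

lemma segment_unique:
  assumes "l \<in> {1..m}" "L (l - 1) \<le> x" "x < L l" and "j \<in> {1..m}" "L (j - 1) \<le> x" "x < L j"
  shows "j = l"
proof (rule ccontr)
  assume "j \<noteq> l"
  then consider "j \<le> l - 1" | "l \<le> j - 1" by linarith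
  then show False
    using L_mono[OF _ pred_le, of j l] L_mono[OF _ pred_le, of l j] assms by cases linarith+
qed

lemma ramp_full: "j \<in> {1..m} \<Longrightarrow> L j \<le> x \<Longrightarrow> ramp j x = 1"
  using L_step[of j] a_pos[of j] by (simp add: ramp_def min_def)

lemma ramp_zero: "j \<in> {1..m} \<Longrightarrow> x \<le> L (j - 1) \<Longrightarrow> ramp j x = 0"
  using a_pos[of j] by (simp add: ramp_def min_def)

lemma ramp_middle:
  "j \<in> {1..m} \<Longrightarrow> L (j - 1) \<le> x \<Longrightarrow> x \<le> L j \<Longrightarrow>
    ramp j x = (exp (x - L (j - 1)) - 1) / (exp (a j) - 1)"
  using L_step[of j] by (simp add: ramp_def)

lemma ramp_mono:
  assumes "j \<in> {1..m}" "x \<le> y" shows "ramp j x \<le> ramp j y"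
  unfolding ramp_def using exp_a_gt_1[OF assms(1)] assms(2)
  by (intro divide_right_mono) auto

lemma ramp_nonneg: "j \<in> {1..m} \<Longrightarrow> 0 \<le> ramp j x"
  using exp_a_gt_1[of j] by (simp add: ramp_def)

text \<open>Segments before \<open>l\<close> are complete and their increments telescope to
  \<open>r (l - 1)\<close>; those after \<open>l\<close> have not begun.\<close>

lemma curve_segment:
  assumes l: "l \<in> {1..m}" and x: "L (l - 1) \<le> x" "x \<le> L l"
  shows "curve x = r (l - 1) + (r l - r (l - 1)) * ((exp (x - L (l - 1)) - 1) / (exp (a l) - 1))"
proof -
  have "{1..m} = {1..l - 1} \<union> ({l} \<union> {l<..m})" using l by auto
  then have "curve x = (\<Sum>j=1..l - 1. (r j - r (j - 1)) * ramp j x) +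
      ((r l - r (l - 1)) * ramp l x + (\<Sum>j\<in>{l<..m}. (r j - r (j - 1)) * ramp j x))"
    unfolding curve_def by (subst \<open>{1..m} = _\<close>, subst sum.union_disjoint, auto)
  also have "(\<Sum>j=1..l - 1. (r j - r (j - 1)) * ramp j x) = (\<Sum>j=1..l - 1. r j - r (j - 1))"
  proof (rule sum.cong[OF refl])
    fix j assume j: "j \<in> {1..l - 1}"
    then have "L j \<le> x" using L_mono[OF _ pred_le[OF l], of j] x by simp
    then show "(r j - r (j - 1)) * ramp j x = r j - r (j - 1)"
      using ramp_full[of j x] j pred_le[OF l] by simp
  qed
  also have "\<dots> = r (l - 1)"
  proof -
    have "(\<Sum>j=1..n. r j - r (j - 1)) = r n" for n
      by (induction n) (auto simp: r_0)
    then show ?thesis .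
  qed
  also have "(\<Sum>j\<in>{l<..m}. (r j - r (j - 1)) * ramp j x) = 0"
  proof (rule sum.neutral, rule ballI)
    fix j assume j: "j \<in> {l<..m}"
    then have jm: "j \<in> {1..m}" and "l \<le> j - 1" by auto
    then have "x \<le> L (j - 1)" using L_mono[OF _ pred_le[OF jm], of l] x by linarith
    then show "(r j - r (j - 1)) * ramp j x = 0"
      using ramp_zero[OF jm] by simp
  qed
  finally show ?thesis using ramp_middle[OF l x] by simp
qed

lemma curve_0: "curve 0 = 0"
  using curve_segment[of 1 0] m_pos L_0 L_mono[of 0 1] by (simp add: r_0)

lemma curve_1: "curve 1 = r m"
proof -
  have "(\<Sum>j=1..m. (r j - r (j - 1)) * ramp j 1) = (\<Sum>j=1..m. r j - r (j - 1))"
    using ramp_full L_mono[of _ m] L_m by (intro sum.cong) auto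
  also have "(\<Sum>j=1..n. r j - r (j - 1)) = r n" for n
    by (induction n) (auto simp: r_0)
  finally show ?thesis by (simp add: curve_def)
qed

lemma curve_nonneg: "0 \<le> curve x"
  unfolding curve_def
  by (intro sum_nonneg mult_nonneg_nonneg ramp_nonneg) (rule r_step_nonneg)

lemma continuous_curve: "continuous_on S curve"
proof -
  have "continuous_on S (\<lambda>x. (exp (max 0 (min (x - L (j - 1)) (a j))) - 1) / (exp (a j) - 1))"
    if "j \<in> {1..m}" for j
    using exp_a_gt_1[OF that] by (intro continuous_intros) auto
  then show ?thesis unfolding curve_def ramp_def
    by (intro continuous_on_sum continuous_on_mult continuous_on_const) auto
qed

lemma measurable_curve: "curve \<in> borel_measurable borel"
  by (rule borel_measurable_continuous_onI[OF continuous_curve])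

lemma measurable_slope [measurable]: "slope j \<in> borel_measurable borel"
  unfolding slope_def by measurable

lemma measurable_curve_deriv [measurable]: "curve_deriv \<in> borel_measurable borel"
  unfolding curve_deriv_def by measurable

lemma slope_nonneg: "j \<in> {1..m} \<Longrightarrow> 0 \<le> slope j x"
  unfolding slope_def using r_less[of j] exp_a_gt_1[of j]
  by (intro divide_nonneg_nonneg mult_nonneg_nonneg) auto

lemma curve_deriv_nonneg: "0 \<le> curve_deriv x"
  unfolding curve_deriv_def by (intro sum_nonneg) (simp add: slope_nonneg)

lemma curve_deriv_segment:
  assumes l: "l \<in> {1..m}" and x: "L (l - 1) \<le> x" "x < L l"
  shows "curve_deriv x = slope l x"
proof -
  have "curve_deriv x = (\<Sum>j=1..m. if j = l then slope l x else 0)"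
    unfolding curve_deriv_def
  proof (rule sum.cong[OF refl])
    fix j assume j: "j \<in> {1..m}"
    show "(if L (j - 1) \<le> x \<and> x < L j then slope j x else 0) = (if j = l then slope l x else 0)"
    proof (cases "j = l")
      case False
      then have "\<not> (L (j - 1) \<le> x \<and> x < L j)" using segment_unique[OF l x j] by blast
      then show ?thesis using False by auto
    qed (use x in simp)
  qed
  then show ?thesis using l by simp
qed

text \<open>No summand decreases, and the ramp of the segment containing \<open>x\<close> is not yet
  full, so it grows strictly.\<close>

lemma curve_strict_mono:
  assumes "0 \<le> x" "x < y" "y \<le> 1"
  shows "curve x < curve y"
proof -
  obtain l where l: "l \<in> {1..m}" "L (l - 1) \<le> x" "x < L l"
    using segment_exists[of x] assms by auto
  have "max 0 (min (x - L (l - 1)) (a l)) < max 0 (min (y - L (l - 1)) (a l))"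
    using l assms L_step[OF l(1)] by auto
  then have "ramp l x < ramp l y"
    unfolding ramp_def using exp_a_gt_1[OF l(1)] by (intro divide_strict_right_mono) auto
  then have "(r l - r (l - 1)) * ramp l x < (r l - r (l - 1)) * ramp l y"
    using r_less[OF l(1)] by simp
  moreover have "(r j - r (j - 1)) * ramp j x \<le> (r j - r (j - 1)) * ramp j y" if "j \<in> {1..m}" for j
    using r_less[OF that] ramp_mono[OF that] assms by (intro mult_left_mono) auto
  ultimately show ?thesis
    unfolding curve_def using l(1) by (intro sum_strict_mono_ex1) auto
qed

lemma inj_on_curve: "inj_on curve {0..1}"
proof (rule inj_onI)
  fix x y assume "x \<in> {0..1}" "y \<in> {0..1}" "curve x = curve y"
  then show "x = y"
    using curve_strict_mono[of x y] curve_strict_mono[of y x] by (cases x y rule: linorder_cases) auto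
qed

text \<open>The differential equation of the value function. It says that a unit sold at
  \<open>r l\<close> and giving the fraction \<open>F\<close> of its score to the customer keeps
  exactly \<open>F * slope l x\<close>. The equations \<open>a_eq\<close> enter as
  \<open>r l * D = F * d * (D + 1)\<close>.\<close>

lemma slope_eq:
  assumes l: "l \<in> {1..m}" and x: "L (l - 1) \<le> x" "x \<le> L l"
  shows "F * slope l x = r l - F * (r l - curve x)"
proof -
  define d D e where "d = r l - r (l - 1)" and "D = exp (a l) - 1" and "e = exp (x - L (l - 1))"
  have D: "D > 0" using exp_a_gt_1[OF l] by (simp add: D_def)
  have "1 - exp (- a l) = F * (d / r l)"
    using a_eq[OF l] r_pos[OF l] by (simp add: d_def field_simps)
  moreover have "1 - exp (- a l) = D / (D + 1)"
    by (simp add: D_def exp_minus field_simps)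
  ultimately have "D / (D + 1) = F * (d / r l)" by simp
  then have key: "r l * D = F * d * (D + 1)"
    using r_pos[OF l] D by (simp add: field_simps)
  have c: "curve x = r l - d + d * ((e - 1) / D)"
    using curve_segment[OF l x] by (simp add: d_def e_def D_def)
  have s: "slope l x = d * e / D" by (simp add: slope_def d_def e_def D_def)
  have "(r l - F * (r l - curve x)) * D = r l * D - F * d * D + F * d * (e - 1)"
    unfolding c using D by (simp add: field_simps)
  also have "\<dots> = F * d * e" unfolding key by (simp add: algebra_simps)
  finally show ?thesis unfolding s using D by (simp add: field_simps)
qed

text \<open>For \<open>s = F\<close> and the lowest price above \<open>curve x\<close>, which is
  \<open>r l\<close>, this is \<open>slope_eq\<close>. A smaller \<open>s\<close> lowers the left
  side and raises the right one, and a higher price raises the right side.\<close>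

lemma curve_deriv_le:
  assumes x: "x \<in> {0..1}" and j: "j \<le> m" and less: "curve x < r j" and s: "0 \<le> s" "s \<le> F"
  shows "s * curve_deriv x \<le> (1 - s) * r j + s * curve x"
proof -
  \<comment> \<open>The half-open segments miss \<open>x = 1\<close>, but no price lies above
    \<open>curve 1 = r m\<close>.\<close>
  have "x \<noteq> 1" using less r_mono[OF j order_refl] curve_1 by auto
  then obtain l where l: "l \<in> {1..m}" "L (l - 1) \<le> x" "x < L l"
    using segment_exists[of x] x by auto
  have seg: "curve x = r (l - 1) + (r l - r (l - 1)) * ((exp (x - L (l - 1)) - 1) / (exp (a l) - 1))"
    using curve_segment l by simp
  have "0 \<le> (r l - r (l - 1)) * ((exp (x - L (l - 1)) - 1) / (exp (a l) - 1))"
    using r_less[OF l(1)] exp_a_gt_1[OF l(1)] l(2)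
    by (intro mult_nonneg_nonneg divide_nonneg_nonneg) auto
  then have "r (l - 1) < r j" using seg less by linarith
  then have "\<not> j \<le> l - 1" using r_mono[OF _ pred_le[OF l(1)], of j] by linarith
  then have "l \<le> j" by simp
  then have rl: "r l \<le> r j" using r_mono j by simp
  have "(exp (x - L (l - 1)) - 1) / (exp (a l) - 1) \<le> 1"
    using exp_a_gt_1[OF l(1)] L_step[OF l(1)] l(3) by simp
  then have cl: "curve x \<le> r l"
    using seg r_less[OF l(1)] mult_left_mono[of "(exp (x - L (l - 1)) - 1) / (exp (a l) - 1)" 1 "r l - r (l - 1)"]
    by simp
  have "s * curve_deriv x \<le> F * slope l x"
    using curve_deriv_segment[OF l] slope_nonneg[OF l(1)] s by (simp add: mult_right_mono)
  also have "\<dots> = r l - F * (r l - curve x)" using slope_eq l by simp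
  also have "\<dots> \<le> r l - s * (r l - curve x)"
    using s cl by (simp add: mult_right_mono)
  also have "\<dots> = (1 - s) * r l + s * curve x" by (simp add: algebra_simps)
  also have "\<dots> \<le> (1 - s) * r j + s * curve x"
    using rl s F_le_1 by (simp add: mult_left_mono)
  finally show ?thesis .
qed

section \<open>Integrals of the derivative\<close>

lemma slope_integral:
  assumes j: "j \<in> {1..m}" and W: "W \<le> 1"
  shows "(\<integral>\<^sup>+x. ennreal (if L (j - 1) \<le> x \<and> x < L j \<and> x < W then slope j x else 0) \<partial>lborel) =
    ennreal ((r j - r (j - 1)) * ramp j W)"
proof -
  \<comment> \<open>The right end of the part of segment \<open>j\<close> below \<open>W\<close>. It
    collapses to \<open>L (j - 1)\<close> when \<open>W\<close> comes earlier, just as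
    \<open>ramp\<close> is clamped at 0.\<close>
  define b where "b = max (L (j - 1)) (min W (L j))"
  let ?H = "\<lambda>x. (r j - r (j - 1)) * ((exp (x - L (j - 1)) - 1) / (exp (a j) - 1))"
  have "(\<integral>\<^sup>+x. ennreal (if L (j - 1) \<le> x \<and> x < L j \<and> x < W then slope j x else 0) \<partial>lborel) =
      (\<integral>\<^sup>+x. ennreal (slope j x) * indicator {L (j - 1)..b} x \<partial>lborel)"
  proof (rule nn_integral_cong_AE, use AE_lborel_singleton[of b] in eventually_elim)
    fix x assume "x \<noteq> b"
    then show "ennreal (if L (j - 1) \<le> x \<and> x < L j \<and> x < W then slope j x else 0) =
        ennreal (slope j x) * indicator {L (j - 1)..b} x"
      by (auto simp: b_def indicator_def max_def min_def split: if_splits)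
  qed
  also have "\<dots> = ennreal (?H b - ?H (L (j - 1)))"
  proof (rule nn_integral_FTC_Icc)
    show "slope j \<in> borel_measurable borel" by (rule measurable_slope)
    show "L (j - 1) \<le> b" by (simp add: b_def)
    show "(?H has_real_derivative slope j x) (at x)" for x
      unfolding slope_def using exp_a_gt_1[OF j]
      by (auto intro!: derivative_eq_intros)
  qed (rule slope_nonneg[OF j])
  also have "b - L (j - 1) = max 0 (min (W - L (j - 1)) (a j))"
    using L_step[OF j] by (auto simp: b_def max_def min_def)
  then have "?H b - ?H (L (j - 1)) = (r j - r (j - 1)) * ramp j W"
    by (simp add: ramp_def)
  finally show ?thesis .
qed

text \<open>The fundamental theorem is applied on each segment separately because of the kinks; the
  ramps at \<open>W\<close> then add up to \<open>curve W\<close>.\<close>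

lemma curve_deriv_integral:
  assumes W: "0 \<le> W" "W \<le> 1"
  shows "(\<integral>\<^sup>+x. ennreal (if x < W then curve_deriv x else 0) \<partial>unif01) = ennreal (curve W)"
proof -
  let ?f = "\<lambda>j x. if L (j - 1) \<le> x \<and> x < L j \<and> x < W then slope j x else 0"
  have "(\<integral>\<^sup>+x. ennreal (if x < W then curve_deriv x else 0) \<partial>unif01) =
      (\<integral>\<^sup>+x. ennreal (if x < W then curve_deriv x else 0) * indicator {0..1} x \<partial>lborel)"
    by (subst nn_integral_uniform_measure) (auto simp: divide_ennreal_def)
  also have "\<dots> = (\<integral>\<^sup>+x. (\<Sum>j=1..m. ennreal (?f j x)) \<partial>lborel)"
  proof (rule nn_integral_cong)
    fix x :: real
    have out: "?f j x = 0" if "x \<notin> {0..1}" "j \<in> {1..m}" for j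
    proof (rule if_not_P, rule notI)
      assume "L (j - 1) \<le> x \<and> x < L j \<and> x < W"
      then have "x \<in> {0..1}" using L_mono[OF _ pred_le[OF that(2)], of 0] L_0 W by simp
      with that(1) show False ..
    qed
    have "(\<Sum>j=1..m. ?f j x) = (if x < W then curve_deriv x else 0)"
      unfolding curve_deriv_def by (auto intro!: sum.cong)
    then have "(\<Sum>j=1..m. ennreal (?f j x)) = ennreal (if x < W then curve_deriv x else 0)"
      by (subst sum_ennreal) (auto simp: slope_nonneg)
    moreover have "(\<Sum>j=1..m. ennreal (?f j x)) = 0" if "x \<notin> {0..1}"
      using out[OF that] by (intro sum.neutral) (simp del: if_split)
    ultimately show "ennreal (if x < W then curve_deriv x else 0) * indicator {0..1} x =
        (\<Sum>j=1..m. ennreal (?f j x))"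
      by (cases "x \<in> {0..1}") (auto simp: indicator_def)
  qed
  also have "\<dots> = (\<Sum>j=1..m. \<integral>\<^sup>+x. ennreal (?f j x) \<partial>lborel)"
    by (rule nn_integral_sum) measurable
  also have "\<dots> = (\<Sum>j=1..m. ennreal ((r j - r (j - 1)) * ramp j W))"
    by (intro sum.cong refl slope_integral W)
  also have "\<dots> = ennreal (curve W)"
    unfolding curve_def
    by (rule sum_ennreal) (rule mult_nonneg_nonneg[OF r_step_nonneg ramp_nonneg])
  finally show ?thesis .
qed

text \<open>By continuity \<open>z = curve W\<close> for some \<open>W\<close>, and by strict
  monotonicity \<open>curve\<close> is below \<open>z\<close> on \<open>[0, W)\<close>, where its
  derivative integrates to \<open>z\<close>. This supplies \<open>h_integral\<close>.\<close>

lemma curve_sublevel_integral: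
  assumes z: "0 \<le> z" "z \<le> r m" and s: "0 \<le> s"
  shows "ennreal (s * z) \<le> (\<integral>\<^sup>+x. ennreal (if curve x < z then s * curve_deriv x else 0) \<partial>unif01)"
proof -
  obtain W where W: "0 \<le> W" "W \<le> 1" "curve W = z"
    using IVT'[of curve 0 z 1] z continuous_curve by (auto simp: curve_0 curve_1)
  have "ennreal (s * z) = ennreal s * (\<integral>\<^sup>+x. ennreal (if x < W then curve_deriv x else 0) \<partial>unif01)"
    using curve_deriv_integral[OF W(1,2)] W(3) s z by (simp add: ennreal_mult)
  also have "\<dots> = (\<integral>\<^sup>+x. ennreal s * ennreal (if x < W then curve_deriv x else 0) \<partial>unif01)"
    by (rule nn_integral_cmult[symmetric]) simp
  also have "\<dots> \<le> (\<integral>\<^sup>+x. ennreal (if curve x < z then s * curve_deriv x else 0) \<partial>unif01)"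
  proof (rule nn_integral_mono_AE, use AE_unif01 in eventually_elim)
    fix x :: real assume "x \<in> {0..1}"
    then show "ennreal s * ennreal (if x < W then curve_deriv x else 0)
        \<le> ennreal (if curve x < z then s * curve_deriv x else 0)"
      using curve_strict_mono[of x W] W s curve_deriv_nonneg[of x]
      by (auto simp: ennreal_mult)
  qed
  finally show ?thesis .
qed

end

section \<open>Price sets and the weights\<close>

lemma price_0: "price P 0 = 0"
  by (simp add: price_def)

lemma price_Suc: "price P (Suc j) = sorted_list_of_set P ! j"
  by (simp add: price_def)

lemma price_less:
  assumes P: "finite P" "\<forall>x\<in>P. 0 < x" and j: "j \<in> {1..card P}"
  shows "price P (j - 1) < price P j"
proof -
  obtain i where i: "j = Suc i" "i < card P" using j by (cases j) auto
  show ?thesis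
  proof (cases i)
    case 0
    have "sorted_list_of_set P ! 0 \<in> set (sorted_list_of_set P)"
      using i 0 by (intro nth_mem) simp
    then show ?thesis using i 0 P by (simp add: price_0 price_Suc)
  next
    case (Suc n)
    have "sorted_wrt (<) (sorted_list_of_set P)" by simp
    then have "sorted_list_of_set P ! n < sorted_list_of_set P ! Suc n"
      by (rule sorted_wrt_nth_less) (use i Suc in auto)
    then show ?thesis using i Suc by (simp add: price_Suc)
  qed
qed

text \<open>The sum is the total weight that belongs to the value \<open>y\<close> of
  \<open>1 - exp (- a 1)\<close>; its strict growth makes this value unique.\<close>

lemma neg_ln_sum_strict_mono:
  fixes s :: "nat \<Rightarrow> real"
  assumes m: "1 \<le> m" and s: "\<And>j. j \<in> {1..m} \<Longrightarrow> 0 < s j \<and> s j \<le> 1"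
    and y: "y < y'" "y' < 1" "0 \<le> y"
  shows "(\<Sum>j=1..m. - ln (1 - s j * y)) < (\<Sum>j=1..m. - ln (1 - s j * y'))"
proof (rule sum_strict_mono)
  fix j assume j: "j \<in> {1..m}"
  have "s j * y' \<le> 1 * y'" using s[OF j] y by (intro mult_right_mono) auto
  moreover have "s j * y < s j * y'" using s[OF j] y by simp
  ultimately have "ln (1 - s j * y') < ln (1 - s j * y)"
    using y by (subst ln_less_cancel_iff) linarith+
  then show "- ln (1 - s j * y) < - ln (1 - s j * y')" by simp
qed (use m in auto)

text \<open>The weights are \<open>a j = - ln (1 - s j * y)\<close>, where \<open>y\<close> is fixed by the condition that they sum to 1.\<close>

lemma ex1_weights:
  fixes s :: "nat \<Rightarrow> real"
  assumes m: "1 \<le> m" and s: "\<And>j. j \<in> {1..m} \<Longrightarrow> 0 < s j \<and> s j \<le> 1" and s1: "s 1 = 1"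
  shows "\<exists>!a. (\<forall>j. j \<notin> {1..m} \<longrightarrow> a j = 0) \<and> (\<forall>j\<in>{1..m}. a j > 0) \<and> (\<Sum>j=1..m. a j) = 1 \<and>
    (\<forall>j\<in>{2..m}. 1 - exp (- a 1) = (1 - exp (- a j)) / s j)" (is "\<exists>!a. ?Q a")
proof -
  define G where "G y = (\<Sum>j=1..m. - ln (1 - s j * y))" for y
  \<comment> \<open>At this value the first weight alone is 1 because \<open>s 1 = 1\<close>, so the
    total is at least 1 and the intermediate value theorem applies.\<close>
  define y1 :: real where "y1 = 1 - exp (- 1)"
  have y1: "0 < y1" "y1 < 1" by (auto simp: y1_def)
  have lt1: "s j * y < 1" if "j \<in> {1..m}" "0 \<le> y" "y < 1" for j y
  proof -
    have "s j * y \<le> 1 * y" using s[OF that(1)] that by (intro mult_right_mono) auto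
    then show ?thesis using that by simp
  qed
  have "G 0 = 0" by (simp add: G_def)
  moreover have "1 \<le> G y1"
  proof -
    have "1 = - ln (1 - s 1 * y1)" unfolding s1 by (simp add: y1_def)
    also have "\<dots> \<le> G y1" unfolding G_def
    proof (rule member_le_sum)
      fix j assume "j \<in> {1..m} - {1}"
      then have j: "j \<in> {1..m}" by simp
      show "0 \<le> - ln (1 - s j * y1)"
        using lt1[OF j, of y1] y1 s[OF j] by simp
    qed (use m in auto)
    finally show ?thesis .
  qed
  moreover have "continuous_on {0..y1} G"
    unfolding G_def
  proof (intro continuous_intros ballI)
    fix j y assume "j \<in> {1..m}" "y \<in> {0..y1}"
    then show "1 - s j * y \<noteq> 0" using lt1[of j y] y1 by auto
  qed
  ultimately obtain y where y: "0 \<le> y" "y \<le> y1" "G y = 1"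
    using IVT'[of G 0 1 y1] y1 by auto
  have y0: "0 < y" using y \<open>G 0 = 0\<close> by (cases "y = 0") auto
  have yl: "y < 1" using y y1 by simp
  define a where "a j = (if j \<in> {1..m} then - ln (1 - s j * y) else 0)" for j
  have exp_a: "1 - exp (- a j) = s j * y" if "j \<in> {1..m}" for j
    using lt1[OF that, of y] y0 yl that by (simp add: a_def)
  have "?Q a"
  proof (intro conjI ballI allI impI)
    fix j assume j: "j \<in> {1..m}"
    show "0 < a j" using lt1[OF j, of y] y0 yl s[OF j] j by (simp add: a_def)
  next
    show "(\<Sum>j=1..m. a j) = 1" using y by (simp add: a_def G_def)
  next
    fix j assume "j \<in> {2..m}"
    then have j: "j \<in> {1..m}" by simp
    show "1 - exp (- a 1) = (1 - exp (- a j)) / s j"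
      using s[OF j] exp_a[OF j] exp_a[of 1, unfolded s1] m by simp
  qed (auto simp: a_def)
  moreover have "b = a" if b: "?Q b" for b
  proof -
    \<comment> \<open>Any solution \<open>b\<close> has the same form as \<open>a\<close> with
      \<open>z\<close> in place of \<open>y\<close>, and \<open>G z = 1 = G y\<close> forces
      \<open>z = y\<close>.\<close>
    define z where "z = 1 - exp (- b 1)"
    have b1: "0 < b 1" using b m by simp
    have z: "0 < z" "z < 1" using b1 by (auto simp: z_def)
    have bj: "b j = - ln (1 - s j * z)" if j: "j \<in> {1..m}" for j
    proof -
      have "s j * z = 1 - exp (- b j)"
      proof (cases "j = 1")
        case False
        then have "z = (1 - exp (- b j)) / s j" using b j by (auto simp: z_def)
        then show ?thesis using s[OF j] by simp
      qed (simp add: s1[simplified] z_def)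
      then show ?thesis by simp
    qed
    have Gz: "G z = 1" unfolding G_def using b bj by simp
    have "\<not> z < y"
      using neg_ln_sum_strict_mono[of m s z y, OF m s] Gz y(3) z(1) yl unfolding G_def by auto
    moreover have "\<not> y < z"
      using neg_ln_sum_strict_mono[of m s y z, OF m s] Gz y(1,3) z(2) unfolding G_def by auto
    ultimately have "z = y" by simp
    then show ?thesis using b bj by (auto simp: a_def fun_eq_iff)
  qed
  ultimately show ?thesis by (rule ex1I)
qed

locale price_list =
  fixes P :: "real set"
  assumes P: "finite P" "P \<noteq> {}" "\<forall>x\<in>P. 0 < x"
begin

lemma card_pos: "1 \<le> card P"
  using P by (simp add: Suc_le_eq card_gt_0_iff)

lemma price_pos: "j \<in> {1..card P} \<Longrightarrow> 0 < price P j"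
proof (induction j)
  case (Suc j)
  then show ?case
    using price_less[OF P(1,3) Suc.prems] by (cases "j = 0") (auto simp: price_0)
qed simp

lemma price_gap: "j \<in> {1..card P} \<Longrightarrow> 0 < 1 - price P (j - 1) / price P j"
  using price_less[OF P(1,3)] price_pos[of j] by simp

lemma price_gap_le_1: "j \<in> {1..card P} \<Longrightarrow> 1 - price P (j - 1) / price P j \<le> 1"
proof -
  assume j: "j \<in> {1..card P}"
  have "0 \<le> price P (j - 1)"
  proof (cases "j = 1")
    case False
    then have "j - 1 \<in> {1..card P}" using j by auto
    then show ?thesis by (rule less_imp_le[OF price_pos])
  qed (simp add: price_0)
  then show ?thesis using price_pos[OF j] by simp
qed

text \<open>\<open>ex1_weights\<close> resolves the definite description in \<open>alpha\<close>. As
  \<open>price P 0 = 0\<close>, the relative gap at \<open>j = 1\<close> is 1, so the last equation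
  extends to \<open>j = 1\<close>.\<close>

lemma
  shows alpha_pos: "\<And>j. j \<in> {1..card P} \<Longrightarrow> 0 < alpha P j"
    and alpha_sum: "(\<Sum>j=1..card P. alpha P j) = 1"
    and alpha_eq: "\<And>j. j \<in> {1..card P} \<Longrightarrow>
      1 - exp (- alpha P j) = F_ratio P * (1 - price P (j - 1) / price P j)"
proof -
  let ?s = "\<lambda>j. 1 - price P (j - 1) / price P j"
  have "\<exists>!a. (\<forall>j. j \<notin> {1..card P} \<longrightarrow> a j = 0) \<and> (\<forall>j\<in>{1..card P}. a j > 0) \<and>
     (\<Sum>j=1..card P. a j) = 1 \<and>
     (\<forall>j\<in>{2..card P}. 1 - exp (- a 1) = (1 - exp (- a j)) / ?s j)"
    by (rule ex1_weights[OF card_pos]) (use price_gap price_gap_le_1 price_0 in auto)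
  from theI'[OF this, folded alpha_def]
  have a: "\<forall>j\<in>{1..card P}. alpha P j > 0" "(\<Sum>j=1..card P. alpha P j) = 1"
    "\<forall>j\<in>{2..card P}. 1 - exp (- alpha P 1) = (1 - exp (- alpha P j)) / ?s j"
    by blast+
  show "0 < alpha P j" if "j \<in> {1..card P}" for j using a that by blast
  show "(\<Sum>j=1..card P. alpha P j) = 1" by (rule a)
  show "1 - exp (- alpha P j) = F_ratio P * ?s j" if j: "j \<in> {1..card P}" for j
  proof (cases "j = 1")
    case False
    then have eq: "F_ratio P = (1 - exp (- alpha P j)) / ?s j"
      using a(3) j by (auto simp: F_ratio_def)
    have "?s j \<noteq> 0" using price_gap[OF j] by linarith
    from iffD1[OF nonzero_eq_divide_eq[OF this] eq] show ?thesis by (rule sym)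
  qed (simp add: F_ratio_def price_0)
qed

sublocale value_curve "card P" "price P" "alpha P" "F_ratio P"
proof
  show "0 < F_ratio P" using alpha_pos[of 1] card_pos by (simp add: F_ratio_def)
  show "F_ratio P \<le> 1" by (simp add: F_ratio_def)
qed (fact card_pos price_0 price_less[OF P(1,3)] alpha_pos alpha_sum alpha_eq)+

lemma L_sum_eq: "L_sum P = L"
  by (simp add: fun_eq_iff L_sum_def L_def)

text \<open>Outside \<open>[0, 1]\<close> no segment contains \<open>x\<close> and
  \<open>ell\<close> is a description without a witness; the draws stay inside almost surely. At 1
  the convention \<open>ell P 1 = card P\<close> fits because \<open>curve_segment\<close> includes
  the right end of a segment.\<close>

lemma Phi_eq_curve:
  assumes "x \<in> {0..1}"
  shows "Phi P x = curve x"
proof (cases "x = 1")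
  case True
  then have "ell P x = card P" by (simp add: ell_def)
  moreover have "card P \<in> {1..card P}" using card_pos by simp
  moreover from this have "L (card P - 1) \<le> 1" "1 \<le> L (card P)"
    using L_mono[OF diff_le_self order_refl] L_m by simp_all
  ultimately show ?thesis
    using curve_segment[of "card P" 1] True by (simp add: Phi_def Let_def L_sum_eq)
next
  case False
  then obtain l where l: "l \<in> {1..card P}" "L (l - 1) \<le> x" "x < L l"
    using segment_exists[of x] assms by auto
  have "ell P x = (THE j. j \<in> {1..card P} \<and> x \<in> {L (j - 1)..<L j})"
    using False by (simp add: ell_def L_sum_eq)
  also have "\<dots> = l"
  proof (rule the_equality)
    fix j assume "j \<in> {1..card P} \<and> x \<in> {L (j - 1)..<L j}"
    then show "j = l" by (intro segment_unique[OF l]) auto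
  qed (use l in auto)
  finally show ?thesis
    using curve_segment[OF l(1,2)] l by (simp add: Phi_def Let_def L_sum_eq)
qed

end

section \<open>The linear program and the algorithm without ties\<close>

lemma finite_copies: "finite (copies S)"
  by (simp add: copies_def items_def)

lemma available_Nil: "available S [] = copies S"
  by (simp add: available_def)

lemma available_snoc: "available S (h @ [(c, d)]) = available S h - set_option d"
  by (cases d) (auto simp: available_def)

text \<open>Without ties the tie rule is never consulted, and the winners form a set of at most one copy.\<close>

lemma ranking_revenue_no_ties:
  assumes "valid_tie_rule tb" "\<And>c. c \<in> set cs \<Longrightarrow> inj_on (score S w c) (copies S)"
  shows "ranking_revenue S tb w h cs = (\<Sum>t<length cs.
    \<Sum>u\<in>winners (score S w (cs ! t)) (remaining (\<lambda>t. score S w (cs ! t)) (available S h) t).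
      best_price S (cs ! t) u)"
  using assms(2)
proof (induction cs arbitrary: h)
  case (Cons c cs)
  define B where "B = winners (score S w c) (available S h)"
  have B_eq: "{u \<in> maximizers S w h c. score S w c u > 0} = B"
    by (auto simp: B_def winners_def maximizers_def)
  define d where "d = assign S tb w h c"
  have d: "set_option d = B" "(case d of None \<Rightarrow> 0 | Some u \<Rightarrow> best_price S c u) = (\<Sum>u\<in>B. best_price S c u)"
  proof -
    have "set_option d = B \<and> (case d of None \<Rightarrow> 0 | Some u \<Rightarrow> best_price S c u) = (\<Sum>u\<in>B. best_price S c u)"
    proof (cases "B = {}")
      case True
      then show ?thesis unfolding d_def assign_def B_eq Let_def by simp
    next
      case False
      then obtain u where u: "u \<in> B" by auto
      have "v = u" if "v \<in> B" for v
      proof (rule inj_onD[OF Cons.prems[of c]])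
        show "score S w c v = score S w c u"
          using u that by (auto simp: B_def winners_def intro: antisym)
      qed (use u that in \<open>auto simp: B_def winners_def available_def\<close>)
      then have B: "B = {u}" using u by blast
      moreover have "tb w h c B \<in> B"
        using assms(1) False by (simp add: valid_tie_rule_def)
      ultimately have "d = Some u"
        unfolding d_def assign_def B_eq Let_def by simp
      then show ?thesis by (simp add: B)
    qed
    then show "set_option d = B" "(case d of None \<Rightarrow> 0 | Some u \<Rightarrow> best_price S c u) = (\<Sum>u\<in>B. best_price S c u)"
      by auto
  qed
  let ?s = "\<lambda>t. score S w ((c # cs) ! t)"
  have av: "available S (h @ [(c, d)]) = available S h - winners (?s 0) (available S h)"
    by (simp add: available_snoc d(1) B_def)
  have rem: "remaining ?s (available S h) (Suc t) =
      remaining (\<lambda>t. score S w (cs ! t)) (available S (h @ [(c, d)])) t" for t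
    unfolding remaining_Suc_shift av by simp
  have "ranking_revenue S tb w h (c # cs) =
      (\<Sum>u\<in>B. best_price S c u) + ranking_revenue S tb w (h @ [(c, d)]) cs"
    by (simp add: d_def[symmetric] Let_def d(2))
  also have "ranking_revenue S tb w (h @ [(c, d)]) cs = (\<Sum>t<length cs.
      \<Sum>u\<in>winners (?s (Suc t)) (remaining ?s (available S h) (Suc t)).
        best_price S ((c # cs) ! Suc t) u)"
    unfolding rem using Cons.prems by (subst Cons.IH) auto
  finally show ?case
    by (simp only: length_Cons sum.lessThan_Suc_shift remaining.simps(1) nth_Cons_0 B_def)
qed simp

section \<open>Accepted prices and linear programming duality\<close>

lemma valid_setup_price_list: "valid_setup S \<Longrightarrow> i \<in> items S \<Longrightarrow> price_list (price_set S i)"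
  by (auto simp: valid_setup_def price_list_def)

lemma best_index_le: "best_index S c i \<le> card (price_set S i)"
proof -
  let ?J = "{j \<in> price_indices S i. c i j = 1}"
  have "finite ?J" by (simp add: price_indices_def)
  then have "?J \<noteq> {} \<Longrightarrow> Max ?J \<in> ?J" by (rule Max_in)
  then show ?thesis by (auto simp: best_index_def price_indices_def Let_def)
qed

lemma best_index_ge:
  assumes "j \<in> price_indices S i" "c i j = 1" shows "j \<le> best_index S c i"
proof -
  let ?J = "{j \<in> price_indices S i. c i j = 1}"
  have "finite ?J" "j \<in> ?J" using assms by (auto simp: price_indices_def)
  then show ?thesis by (auto simp: best_index_def Let_def)
qed

text \<open>Weak duality with \<open>lam i\<close> for the inventory and \<open>y t\<close> for the
  customers; the factor \<open>s\<close> saves dividing the shares by it. A rejected price adds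
  nothing to the objective, so the dual constraint is asked for accepted prices only.\<close>

lemma lp_weak_duality:
  assumes det: "deterministic S A" and x: "lp_feasible S A x" and s: "0 \<le> s"
    and lam: "\<And>i. i \<in> items S \<Longrightarrow> 0 \<le> lam i"
    and y: "\<And>t. t < length A \<Longrightarrow> 0 \<le> y t"
    and dual: "\<And>t i j. t < length A \<Longrightarrow> i \<in> items S \<Longrightarrow> j \<in> price_indices S i \<Longrightarrow>
      (A ! t) i j = 1 \<Longrightarrow> s * price (price_set S i) j \<le> lam i + y t"
  shows "s * lp_objective S A x \<le>
    (\<Sum>i\<in>items S. real (inventory S i) * lam i) + (\<Sum>t<length A. y t)"
proof -
  have x0: "0 \<le> x t i j" if "t < length A" "i \<in> items S" "j \<in> price_indices S i" for t i j
    using x that by (simp add: lp_feasible_def)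
  have "s * lp_objective S A x = (\<Sum>t<length A. \<Sum>i\<in>items S. \<Sum>j\<in>price_indices S i.
      s * ((A ! t) i j * price (price_set S i) j * x t i j))"
    by (simp add: lp_objective_def sum_distrib_left)
  also have "\<dots> \<le> (\<Sum>t<length A. \<Sum>i\<in>items S. \<Sum>j\<in>price_indices S i.
      (A ! t) i j * x t i j * lam i + x t i j * y t)"
  proof (intro sum_mono)
    fix t i j assume tij: "t \<in> {..<length A}" "i \<in> items S" "j \<in> price_indices S i"
    then have "(A ! t) i j \<in> {0, 1}" using det by (auto simp: deterministic_def)
    then show "s * ((A ! t) i j * price (price_set S i) j * x t i j)
        \<le> (A ! t) i j * x t i j * lam i + x t i j * y t"
    proof (elim insertE emptyE)
      assume "(A ! t) i j = 0"
      then show ?thesis using x0 y tij by simp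
    next
      assume a: "(A ! t) i j = 1"
      have "s * price (price_set S i) j * x t i j \<le> (lam i + y t) * x t i j"
        using dual[of t i j] a x0 tij by (intro mult_right_mono) auto
      then show ?thesis using a by (simp add: algebra_simps)
    qed
  qed
  also have "\<dots> = (\<Sum>t<length A. \<Sum>i\<in>items S. (\<Sum>j\<in>price_indices S i. (A ! t) i j * x t i j) * lam i) +
      (\<Sum>t<length A. (\<Sum>i\<in>items S. \<Sum>j\<in>price_indices S i. x t i j) * y t)"
    by (simp add: sum.distrib sum_distrib_right)
  also have "(\<Sum>t<length A. \<Sum>i\<in>items S. (\<Sum>j\<in>price_indices S i. (A ! t) i j * x t i j) * lam i) =
      (\<Sum>i\<in>items S. (\<Sum>t<length A. \<Sum>j\<in>price_indices S i. (A ! t) i j * x t i j) * lam i)"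
    by (subst sum.swap) (simp add: sum_distrib_right)
  also have "\<dots> \<le> (\<Sum>i\<in>items S. real (inventory S i) * lam i)"
    using x lam by (intro sum_mono mult_right_mono) (auto simp: lp_feasible_def)
  also have "(\<Sum>t<length A. (\<Sum>i\<in>items S. \<Sum>j\<in>price_indices S i. x t i j) * y t) \<le> (\<Sum>t<length A. 1 * y t)"
    using x y by (intro sum_mono mult_right_mono) (auto simp: lp_feasible_def)
  finally show ?thesis by simp
qed

text \<open>A supremum of reals is bounded only over a nonempty set; the zero solution provides a
  feasible point.\<close>

lemma OPT_le:
  assumes "\<And>x. lp_feasible S A x \<Longrightarrow> s * lp_objective S A x \<le> b" and s: "0 < s"
  shows "s * OPT S A \<le> b"
proof -
  have "lp_feasible S A (\<lambda>_ _ _. 0)" by (simp add: lp_feasible_def)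
  then have "OPT S A \<le> b / s"
    unfolding OPT_def using assms
    by (intro cSUP_least) (auto simp: field_simps)
  then show ?thesis using s by (simp add: field_simps)
qed

text \<open>Here \<open>f\<close> is the revenue under an arbitrary tie rule. It may fail to be
  measurable for \<open>M\<close>, but agreeing almost everywhere with \<open>g\<close> makes it
  measurable for the completion.\<close>

lemma integral_completion_AE:
  fixes f g :: "'a \<Rightarrow> real"
  assumes g: "g \<in> borel_measurable M" and eq: "AE x in M. f x = g x"
  shows "integral\<^sup>L (completion M) f = integral\<^sup>L M g"
proof -
  have gm: "g \<in> borel_measurable (completion M)"
    using g by (rule measurable_completion)
  have ae: "AE x in completion M. f x = g x" using eq by (rule AE_completion)
  have "f \<in> borel_measurable (completion M)"
  proof (rule measurableI)
    fix B :: "real set" assume B: "B \<in> sets borel"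
    show "f -` B \<inter> space (completion M) \<in> sets (completion M)"
    proof (rule completion.in_sets_AE)
      show "g -` B \<inter> space (completion M) \<in> sets (completion M)"
        using gm B by (rule measurable_sets)
      show "AE x in completion M. (x \<in> g -` B \<inter> space (completion M)) = (x \<in> f -` B \<inter> space (completion M))"
        using ae by eventually_elim auto
    qed auto
  qed simp
  then have "integral\<^sup>L (completion M) f = integral\<^sup>L (completion M) g"
    using gm ae by (rule integral_cong_AE)
  also have "\<dots> = integral\<^sup>L M g" using g by (rule integral_completion)
  finally show ?thesis .
qed

section \<open>Competitive ratio\<close>

abbreviation unit_curve :: "pricing_setup \<Rightarrow> copy \<Rightarrow> real \<Rightarrow> real" where
  "unit_curve S u \<equiv> value_curve.curve (card (price_set S (fst u))) (price (price_set S (fst u)))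
     (alpha (price_set S (fst u)))"

abbreviation unit_deriv :: "pricing_setup \<Rightarrow> copy \<Rightarrow> real \<Rightarrow> real" where
  "unit_deriv S u \<equiv> value_curve.curve_deriv (card (price_set S (fst u)))
     (price (price_set S (fst u))) (alpha (price_set S (fst u)))"

lemma fst_copies: "u \<in> copies S \<Longrightarrow> fst u \<in> items S"
  by (auto simp: copies_def)

text \<open>The locale asks for nonnegativity and measurability on all reals, hence
  \<open>unit_curve\<close> in place of \<open>Phi\<close>.\<close>

lemma ranking_instance:
  assumes S: "valid_setup S" and s: "0 \<le> s" "\<And>i. i \<in> items S \<Longrightarrow> s \<le> F_ratio (price_set S i)"
    and "items S \<noteq> {}"
  shows "ranking (copies S) (length A) (\<lambda>t u. best_price S (A ! t) u) (unit_curve S)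
    (\<lambda>u x. s * unit_deriv S u x) s"
proof
  show "s \<le> 1"
  proof -
    obtain i where i: "i \<in> items S" using assms(4) by auto
    interpret price_list "price_set S i" by (rule valid_setup_price_list[OF S i])
    show ?thesis using s(2)[OF i] F_le_1 by simp
  qed
next
  fix u assume u: "u \<in> copies S"
  interpret price_list "price_set S (fst u)"
    by (rule valid_setup_price_list[OF S fst_copies[OF u]])
  have p: "0 \<le> best_price S c u" "best_price S c u \<le> price (price_set S (fst u)) (card (price_set S (fst u)))" for c
    unfolding best_price_def using r_nonneg r_mono best_index_le by blast+
  show "0 \<le> best_price S (A ! t) u" for t by (rule p)
  show "0 \<le> unit_curve S u x" for x by (rule curve_nonneg)
  show "unit_curve S u \<in> borel_measurable borel" by (rule measurable_curve)
  show "(\<lambda>x. s * unit_deriv S u x) \<in> borel_measurable borel"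
    using measurable_curve_deriv by measurable
  show "0 \<le> s * unit_deriv S u x" for x using s(1) curve_deriv_nonneg by simp
  show "s * unit_deriv S u x \<le> (1 - s) * best_price S (A ! t) u + s * unit_curve S u x"
    if "x \<in> {0..1}" "unit_curve S u x < best_price S (A ! t) u" for t x
    using that s(1) s(2)[OF fst_copies[OF u]] unfolding best_price_def
    by (intro curve_deriv_le best_index_le)
  show "ennreal (s * z) \<le>
      (\<integral>\<^sup>+x. ennreal (if unit_curve S u x < z then s * unit_deriv S u x else 0) \<partial>unif01)"
    if "0 \<le> z" "z \<le> best_price S (A ! t) u" for t z
    using that(1) order_trans[OF that(2) p(2)] s(1) by (rule curve_sublevel_integral)
qed (fact finite_copies s(1))+

text \<open>Almost surely all draws lie in \<open>[0, 1]\<close> and no two scores coincide at any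
  of the finitely many customers. On this event the algorithm and the greedy run sell the same
  copies.\<close>

lemma ranking_expected_revenue_eq:
  assumes S: "valid_setup S" and tb: "valid_tie_rule tb"
    and R: "ranking (copies S) (length A) (\<lambda>t u. best_price S (A ! t) u) (unit_curve S) h s"
  shows "ranking_expected_revenue S tb A =
    (\<integral>w. ranking.revenue (copies S) (length A) (\<lambda>t u. best_price S (A ! t) u) (unit_curve S) w
      \<partial>Pi\<^sub>M (copies S) (\<lambda>_. unif01))"
proof -
  interpret ranking "copies S" "length A" "\<lambda>t u. best_price S (A ! t) u" "unit_curve S" h s
    by (rule R)
  have plist: "price_list (price_set S (fst u))" if "u \<in> copies S" for u
    by (rule valid_setup_price_list[OF S fst_copies[OF that]])
  have ae01: "AE w in prod_unif. \<forall>u\<in>copies S. w u \<in> {0..1}"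
    by (intro AE_finite_allI finite_copies AE_PiM_component prob_space_unif01 AE_unif01)
  have "AE w in prod_unif. \<forall>u\<in>copies S. \<forall>v\<in>copies S. u \<noteq> v \<longrightarrow> sc w t u \<noteq> sc w t v" for t
  proof (intro AE_finite_allI finite_copies)
    fix u v assume uv: "u \<in> copies S" "v \<in> copies S"
    show "AE w in prod_unif. u \<noteq> v \<longrightarrow> sc w t u \<noteq> sc w t v"
    proof (cases "u = v")
      case False
      interpret price_list "price_set S (fst u)" by (rule plist[OF uv(1)])
      show ?thesis using AE_no_ties[OF uv False inj_on_curve, of t] by eventually_elim simp
    qed simp
  qed
  then have "AE w in prod_unif. \<forall>t\<in>{..<length A}. \<forall>u\<in>copies S. \<forall>v\<in>copies S. u \<noteq> v \<longrightarrow> sc w t u \<noteq> sc w t v"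
    by (rule AE_finite_allI[OF finite_lessThan])
  with ae01 have "AE w in prod_unif. ranking_revenue S tb w [] A = revenue w"
  proof eventually_elim
    case (elim w)
    have score: "score S w (A ! t) u = sc w t u" if "u \<in> copies S" for t u
    proof -
      interpret price_list "price_set S (fst u)" by (rule plist[OF that])
      show ?thesis using Phi_eq_curve[of "w u"] elim(1) that by (simp add: score_def sc_def)
    qed
    have inj: "inj_on (score S w c) (copies S)" if c: "c \<in> set A" for c
    proof (rule inj_onI)
      fix u v assume uv: "u \<in> copies S" "v \<in> copies S" "score S w c u = score S w c v"
      obtain t where t: "t < length A" "c = A ! t" using c by (auto simp: in_set_conv_nth)
      then have "sc w t u = sc w t v" using uv score by simp
      moreover have "t \<in> {..<length A}" using t by simp
      then have "u \<noteq> v \<longrightarrow> sc w t u \<noteq> sc w t v" using elim(2) uv(1,2) by (elim ballE) auto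
      ultimately show "u = v" by blast
    qed
    have rem: "remaining (\<lambda>t. score S w (A ! t)) (copies S) t = remaining (sc w) (copies S) t" for t
      by (rule remaining_cong) (rule score)
    have win: "winners (score S w (A ! t)) (remaining (sc w) (copies S) t) = sold w t" for t
    proof -
      have "v \<in> copies S" if "v \<in> remaining (sc w) (copies S) t" for v
        using that remaining_subset by (rule rev_subsetD)
      then show ?thesis unfolding sold_def winners_def using score by (auto simp: score)
    qed
    show ?case
      by (subst ranking_revenue_no_ties[OF tb]) (simp_all add: inj available_Nil rem win revenue_def)
  qed
  then show ?thesis
    unfolding ranking_expected_revenue_def draws_def
    by (intro integral_completion_AE borel_measurable_integrable integrable_revenue)
qed

theorem theorem2:
  fixes S :: pricing_setup and tb :: tie_rule
  assumes "valid_setup S" and "valid_tie_rule tb"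
  shows "achieves_competitive_ratio S {A. deterministic S A}
           (ranking_expected_revenue S tb) (MIN i\<in>items S. F_ratio (price_set S i))"
  unfolding achieves_competitive_ratio_def
proof (intro ballI, unfold mem_Collect_eq)
  fix A assume det: "deterministic S A"
  define s where "s = (MIN i\<in>items S. F_ratio (price_set S i))"
  have items: "finite (items S)" "items S \<noteq> {}"
    using assms(1) by (auto simp: items_def valid_setup_def)
  have s_le: "s \<le> F_ratio (price_set S i)" if "i \<in> items S" for i
    unfolding s_def using items that by (intro Min_le) auto
  have "s \<in> (\<lambda>i. F_ratio (price_set S i)) ` items S"
    unfolding s_def using items by (intro Min_in) auto
  then obtain i0 where i0: "i0 \<in> items S" "s = F_ratio (price_set S i0)" by auto
  interpret P0: price_list "price_set S i0" by (rule valid_setup_price_list[OF assms(1) i0(1)])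
  have s_pos: "0 < s" using P0.F_pos i0 by simp
  have R: "ranking (copies S) (length A) (\<lambda>t u. best_price S (A ! t) u) (unit_curve S)
      (\<lambda>u x. s * unit_deriv S u x) s"
    using s_pos by (intro ranking_instance assms(1) s_le items) auto
  interpret ranking "copies S" "length A" "\<lambda>t u. best_price S (A ! t) u" "unit_curve S"
    "\<lambda>u x. s * unit_deriv S u x" s by (rule R)
  define y where "y t = (\<integral>w. customer_share w t \<partial>prod_unif)" for t
  define z where "z u = (\<integral>w. item_share w u \<partial>prod_unif)" for u
  \<comment> \<open>An item without units gets a sufficiently large dual variable, which costs nothing.\<close>
  define lam where "lam i = (if inventory S i = 0 then s * price (price_set S i) (card (price_set S i))
    else (\<Sum>q<inventory S i. z (i, q)) / real (inventory S i))" for i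
  have y0: "0 \<le> y t" for t
    unfolding y_def by (intro Bochner_Integration.integral_nonneg) (simp add: customer_share_nonneg)
  have z0: "0 \<le> z u" if "u \<in> copies S" for u
    unfolding z_def using that by (intro Bochner_Integration.integral_nonneg) (simp add: item_share_nonneg)
  have share: "s * best_price S (A ! t) u \<le> y t + z u" if "t < length A" "u \<in> copies S" for t u
    using expected_shares_ge[OF that] by (simp add: y_def z_def)
  have unit: "(i, q) \<in> copies S" if "i \<in> items S" "q < inventory S i" for i q
    using that by (simp add: copies_def)
  have dual: "s * price (price_set S i) j \<le> lam i + y t"
    if t: "t < length A" and i: "i \<in> items S" and j: "j \<in> price_indices S i" and a: "(A ! t) i j = 1"
    for t i j
  proof -
    interpret P: price_list "price_set S i" by (rule valid_setup_price_list[OF assms(1) i])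
    show ?thesis
    proof (cases "inventory S i = 0")
      case True
      have "price (price_set S i) j \<le> price (price_set S i) (card (price_set S i))"
        using j by (intro P.r_mono) (auto simp: price_indices_def)
      then have "s * price (price_set S i) j \<le> lam i"
        using s_pos True by (simp add: lam_def)
      then show ?thesis using y0[of t] by linarith
    next
      case False
      let ?k = "real (inventory S i)"
      \<comment> \<open>The algorithm always charges the best accepted price, so the constraint at
        that price implies those at the lower ones.\<close>
      have "price (price_set S i) j \<le> price (price_set S i) (best_index S (A ! t) i)"
        using best_index_ge[of j S i "A ! t", OF j a] best_index_le by (rule P.r_mono)
      then have le: "s * price (price_set S i) j - y t \<le> z (i, q)" if "q < inventory S i" for q
        using share[OF t unit[OF i that]] mult_left_mono[OF _ less_imp_le[OF s_pos]]
        by (fastforce simp: best_price_def)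
      \<comment> \<open>The constraint holds for every copy, hence for the average
        \<open>lam i\<close> over the copies.\<close>
      have "?k * (s * price (price_set S i) j - y t) = (\<Sum>q<inventory S i. s * price (price_set S i) j - y t)"
        by simp
      also have "\<dots> \<le> (\<Sum>q<inventory S i. z (i, q))"
        by (rule sum_mono) (use le in simp)
      also have "\<dots> = ?k * lam i" using False by (simp add: lam_def)
      finally have "s * price (price_set S i) j - y t \<le> lam i" using False by simp
      then show ?thesis by linarith
    qed
  qed
  have lam0: "0 \<le> lam i" if i: "i \<in> items S" for i
  proof -
    interpret P: price_list "price_set S i" by (rule valid_setup_price_list[OF assms(1) i])
    show ?thesis using s_pos P.r_nonneg[OF order_refl] z0[OF unit[OF i]]
      by (auto simp: lam_def intro!: sum_nonneg divide_nonneg_nonneg)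
  qed
  have "(\<Sum>i\<in>items S. real (inventory S i) * lam i) = (\<Sum>i\<in>items S. \<Sum>q<inventory S i. z (i, q))"
    by (intro sum.cong) (auto simp: lam_def)
  also have "\<dots> = (\<Sum>u\<in>copies S. z u)"
    unfolding copies_def using items by (subst sum.Sigma) auto
  finally have lam_sum: "(\<Sum>i\<in>items S. real (inventory S i) * lam i) = (\<Sum>u\<in>copies S. z u)" .
  have "s * OPT S A \<le> (\<Sum>i\<in>items S. real (inventory S i) * lam i) + (\<Sum>t<length A. y t)"
    by (intro OPT_le lp_weak_duality det s_pos less_imp_le[OF s_pos] lam0 y0 dual)
  also have "\<dots> = (\<integral>w. revenue w \<partial>prod_unif)"
    unfolding lam_sum expected_revenue y_def z_def by simp
  also have "\<dots> = ranking_expected_revenue S tb A"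
    by (rule ranking_expected_revenue_eq[OF assms R, symmetric])
  finally show "(MIN i\<in>items S. F_ratio (price_set S i)) * OPT S A \<le> ranking_expected_revenue S tb A"
    unfolding s_def .
qed

end
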